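(* Let $s\in\mathbb{N}$ and $k\in\mathbb{Z}$ with $k\ne0$. Then: (a) for even $n\in[2,2s]$, $$e(A_n^{\rm Per})\le\frac1{(2\pi|k|)^{n/2}};$$ (b) for integers $n>2s$, $$e(A_n^{\rm Per})\le\left(\frac3{2\pi}\right)^s\frac{2}{(n-2s+1+|k|)^s}.$$
   Context: For $s\in\mathbb{N}=\{1,2,\dots\}$ let $H^s=\{f:[0,1]\to\mathbb{C} : f^{(s-1)}\text{ is absolutely continuous},\ f^{(s)}\in L_2([0,1])\}$ with inner product $$\langle f,g\rangle_s=\sum_{\ell=0}^{s-1}\int_0^1 f^{(\ell)}(x)\,dx\ \int_0^1\overline{g^{(\ell)}(x)}\,dx+\int_0^1 f^{(s)}(x)\,\overline{g^{(s)}(x)}\,dx$$ and norm $\|f\|_{H^s}=\langle f,f\rangle_s^{1/2}$. The periodic subspace is $\widetilde H^s=\{f\in H^s : f^{(\ell)}(0)=f^{(\ell)}(1)\text{ for }\ell=0,\dots,s-1\}$. For $k\in\mathbb{Z}$, $I_k(f)=\int_0^1 f(x)\,e^{-2\pi i kx}\,dx$. For an algorithm $A:H^s\to\mathbb{C}$, $e(A)=\sup\{|I_k(f)-A(f)| : f\in H^s,\ \|f\|_{H^s}\le1\}$. $B_m^*=B_m/m!$ denotes the normalized Bernoulli polynomial ($B_m$ being the Bernoulli polynomial of degree $m$, the unique polynomial with $\int_t^{t+1}B_m(x)\,dx=t^m$ for all $t\in\mathbb{R}$). For $f\in H^s$ and $1\le j\le s$ put $$p_{f,j}(x)=\sum_{m=0}^{j-1}\bigl(f^{(m)}(1)-f^{(m)}(0)\bigr)B_{m+1}^*(x);$$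 then $f-p_{f,s}\in\widetilde H^s$. For $g\in\widetilde H^s$ and $n\in\{0,1,\dots\}$ let $A_n^*(g)=0$ if $n=0$ or $n<2|k|$, and $A_n^*(g)=\frac1n\sum_{j=1}^n g(j/n)\,e^{-2\pi i kj/n}$ if $n\ge\max(1,2|k|)$. The algorithm $A_n^{\rm Per}$ (for $k\neq 0$) is defined by $A_n^{\rm Per}(f)=I_k(p_{f,n/2})$ for even $n\in[2,2s)$, and $A_n^{\rm Per}(f)=I_k(p_{f,s})+A_{\ell+1}^*(f-p_{f,s})$ for $n=2s+\ell$ with $\ell\in\{0,1,2,\dots\}$. *)

theory Defs
  imports "HOL-Analysis.Analysis" "HOL-Computational_Algebra.Polynomial"
begin

text \<open>
  Functions \<open>[0,1] \<rightarrow> \<complex>\<close> are represented by total functions \<open>real \<Rightarrow> complex\<close>.  None of the notions below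
  depends on the values outside \<open>{0..1}\<close>; in particular, derivatives are taken within \<open>{0..1}\<close>, so
  that they are one-sided at the endpoints.
\<close>

text \<open>
  Where the derivative does not exist, \<^const>\<open>vector_derivative\<close> is some unspecified value.  This is harmless:
  \<open>Hs\<close> below requires the derivatives of order less than \<open>s\<close> to exist everywhere on \<open>{0..1}\<close>, and
  the derivative of order \<open>s\<close>, which exists almost everywhere, is used only under integrals
  over the complete measure \<^const>\<open>lebesgue\<close>.
\<close>

fun hderiv :: "nat \<Rightarrow> (real \<Rightarrow> complex) \<Rightarrow> real \<Rightarrow> complex" where
  "hderiv 0 f = f"
| "hderiv (Suc l) f = (\<lambda>x. vector_derivative (hderiv l f) (at x within {0..1}))"

text \<open>
  The usual \<open>\<epsilon>\<close>-\<open>\<delta>\<close> definition: \<open>D\<close> is a finite family of non-overlapping compact intervals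
  \<open>K = {Inf K..Sup K}\<close>.
\<close>

definition abs_cont_on :: "real set \<Rightarrow> (real \<Rightarrow> complex) \<Rightarrow> bool" where
  "abs_cont_on S f \<longleftrightarrow>
     (\<forall>\<epsilon>>0. \<exists>\<delta>>0. \<forall>D. D division_of \<Union>D \<and> \<Union>D \<subseteq> S \<and> (\<Sum>K\<in>D. Sup K - Inf K) < \<delta> \<longrightarrow>
        (\<Sum>K\<in>D. norm (f (Sup K) - f (Inf K))) < \<epsilon>)"

definition Hs :: "nat \<Rightarrow> (real \<Rightarrow> complex) set" where
  "Hs s = {f.
     (\<forall>l < s - 1. \<forall>x\<in>{0..1}. hderiv l f differentiable (at x within {0..1})) \<and>
     abs_cont_on {0..1} (hderiv (s - 1) f) \<and>
     set_borel_measurable lebesgue {0..1} (hderiv s f) \<and>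
     set_integrable lebesgue {0..1} (\<lambda>x. (norm (hderiv s f x))\<^sup>2)}"

definition Hs_inner :: "nat \<Rightarrow> (real \<Rightarrow> complex) \<Rightarrow> (real \<Rightarrow> complex) \<Rightarrow> complex" where
  "Hs_inner s f g =
     (\<Sum>l<s. (LINT x:{0..1}|lebesgue. hderiv l f x) * (LINT x:{0..1}|lebesgue. cnj (hderiv l g x)))
     + (LINT x:{0..1}|lebesgue. hderiv s f x * cnj (hderiv s g x))"

definition Hs_norm :: "nat \<Rightarrow> (real \<Rightarrow> complex) \<Rightarrow> real" where
  "Hs_norm s f = sqrt (Re (Hs_inner s f f))"

definition osc_integral :: "int \<Rightarrow> (real \<Rightarrow> complex) \<Rightarrow> complex" where
  "osc_integral k f = (LINT x:{0..1}|lebesgue. f x * exp (- (2 * of_real pi * \<i> * of_int k * of_real x)))"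

text \<open>The supremum is taken in \<^typ>\<open>ereal\<close>, so that an unbounded error is \<open>\<infinity>\<close>.\<close>

definition wc_error :: "nat \<Rightarrow> int \<Rightarrow> ((real \<Rightarrow> complex) \<Rightarrow> complex) \<Rightarrow> ereal" where
  "wc_error s k A = (SUP f\<in>{f \<in> Hs s. Hs_norm s f \<le> 1}. ereal (norm (osc_integral k f - A f)))"

definition bernoulli_poly :: "nat \<Rightarrow> real poly" where
  "bernoulli_poly m = (THE p. \<forall>t. (LINT x:{t..t+1}|lebesgue. poly p x) = t ^ m)"

definition bernoulli_normalized :: "nat \<Rightarrow> real \<Rightarrow> real" where
  "bernoulli_normalized m x = poly (bernoulli_poly m) x / fact m"

definition bernoulli_part :: "(real \<Rightarrow> complex) \<Rightarrow> nat \<Rightarrow> real \<Rightarrow> complex" where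
  "bernoulli_part f j x =
     (\<Sum>m<j. (hderiv m f 1 - hderiv m f 0) * of_real (bernoulli_normalized (m + 1) x))"

definition A_star :: "int \<Rightarrow> nat \<Rightarrow> (real \<Rightarrow> complex) \<Rightarrow> complex" where
  "A_star k n g =
     (if n = 0 \<or> int n < 2 * \<bar>k\<bar> then 0
      else 1 / of_nat n *
        (\<Sum>j=1..n. g (real j / real n) *
           exp (- (2 * of_real pi * \<i> * of_int k * of_nat j / of_nat n))))"

text \<open>The algorithm is defined only for even \<open>n \<in> [2,2s)\<close> and for all \<open>n \<ge> 2s\<close>.\<close>

definition A_Per :: "nat \<Rightarrow> int \<Rightarrow> nat \<Rightarrow> (real \<Rightarrow> complex) \<Rightarrow> complex" where
  "A_Per s k n f =
     (if even n \<and> 2 \<le> n \<and> n < 2 * s then osc_integral k (bernoulli_part f (n div 2))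
      else if 2 * s \<le> n then
        osc_integral k (bernoulli_part f s)
          + A_star k (n - 2 * s + 1) (\<lambda>x. f x - bernoulli_part f s x)
      else undefined)"

end

theory Submission
  imports Defs
begin

text \<open>
  Integrating \<open>I\<^sub>k(f)\<close> by parts \<open>j \<le> s\<close> times produces boundary terms
  \<open>(f\<^sup>(\<^sup>m\<^sup>)(1) - f\<^sup>(\<^sup>m\<^sup>)(0)) / (2\<pi>ik)\<^sup>m\<^sup>+\<^sup>1\<close>, \<open>m < j\<close>, and the remainder
  \<open>I\<^sub>k(f\<^sup>(\<^sup>j\<^sup>)) / (2\<pi>ik)\<^sup>j\<close>. The normalized Bernoulli polynomial of degree \<open>m + 1\<close> has
  the coefficient \<open>-1 / (2\<pi>ik)\<^sup>m\<^sup>+\<^sup>1\<close>, so \<open>bernoulli_part f j\<close> has exactly the boundary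
  terms of \<open>f\<close>, and \<open>I\<^sub>k(f) - I\<^sub>k(bernoulli_part f j) = I\<^sub>k(f\<^sup>(\<^sup>j\<^sup>)) / (2\<pi>ik)\<^sup>j\<close>
  (\<open>osc_integral_minus_bernoulli_part\<close>). Poincare's inequality bounds the \<open>L\<^sub>2\<close> norm of
  \<open>f\<^sup>(\<^sup>j\<^sup>)\<close> by the norm of \<open>H\<^sup>s\<close> (\<open>L2_norm_sq_hderiv_le\<close>), which is the first claim. For \<open>n = 2s\<close>
  the quadrature rule has a single node and vanishes.

  In the second claim the rule has \<open>N = n - 2s + 1\<close> nodes. If \<open>N < 2\<bar>k\<bar>\<close>, it vanishes too, and the
  same estimate suffices because \<open>N + \<bar>k\<bar> < 3\<bar>k\<bar>\<close>. If \<open>N \<ge> 2\<bar>k\<bar>\<close>, the rectangle rule applied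
  to a periodic function commits an aliasing error: the error is the sum of the Fourier
  coefficients of \<open>f - bernoulli_part f s\<close> at the frequencies \<open>k - mN\<close>, \<open>m \<noteq> 0\<close> (\<open>aliasing\<close>).
  These are the coefficients of \<open>f\<^sup>(\<^sup>s\<^sup>)\<close> divided by \<open>(2\<pi>i(k - mN))\<^sup>s\<close>, so Cauchy-Schwarz and
  Bessel's inequality reduce the claim to an estimate of \<open>\<Sum> \<bar>k - mN\<bar>\<^sup>-\<^sup>2\<^sup>s\<close>
  (\<open>sum_aliased_weights_le\<close>). The reason for the aliasing formula is that the quadrature error is
  the integral of the derivative against a sawtooth function, whose Fourier series converges in
  mean square by the Basel identity.

  All integrations by parts at the highest order rest on two facts about absolutely continuous
  functions, which are derived from the Vitali covering theorem and the Henstock-Kurzweil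
  integral: such functions are differentiable almost everywhere
  (\<open>abs_continuous_differentiable_ae\<close>), and they are the integrals of their derivatives
  (\<open>abs_continuous_FTC\<close>).
\<close>

section \<open>Finite families of intervals and Vitali coverings\<close>

lemma endpoints_in_division:
  fixes D :: "real set set"
  assumes "D division_of S" "K \<in> D"
  shows "Inf K \<in> K" "Sup K \<in> K" "Inf K \<le> Sup K"
proof -
  obtain a b where "K = cbox a b" "K \<noteq> {}"
    using division_ofD(3,4)[OF assms] by blast
  then show "Inf K \<in> K" "Sup K \<in> K" "Inf K \<le> Sup K"
    by auto
qed

lemma division_telescope:
  fixes F :: "real \<Rightarrow> 'a::real_normed_vector"
  assumes D: "D division_of {a..b}" and "a \<le> b"
  shows "(\<Sum>K\<in>D. F (Sup K) - F (Inf K)) = F b - F a"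
proof -
  have inj: "inj_on (\<lambda>K. (Inf K, K)) D"
    by (auto simp: inj_on_def)
  have "Inf K \<in> K" if "K \<in> D" for K
    using endpoints_in_division[OF D that] by simp
  then have "(\<lambda>K. (Inf K, K)) ` D tagged_division_of {a..b}"
  proof (intro tagged_division_ofI)
    fix x K assume "(x, K) \<in> (\<lambda>K. (Inf K, K)) ` D"
    then have "K \<in> D" "x = Inf K" by auto
    then show "K \<subseteq> {a..b}" "\<exists>a b. K = cbox a b"
      using division_ofD(2,4)[OF D] by blast+
    fix x' K' assume "(x', K') \<in> (\<lambda>K. (Inf K, K)) ` D" "(x, K) \<noteq> (x', K')"
    with \<open>x = Inf K\<close> have "K' \<in> D" "K \<noteq> K'" by auto
    with \<open>K \<in> D\<close> show "interior K \<inter> interior K' = {}"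
      using division_ofD(5)[OF D] by blast
  next
    show "\<Union>{K. \<exists>x. (x, K) \<in> (\<lambda>K. (Inf K, K)) ` D} = {a..b}"
      using division_ofD(6)[OF D] by (auto simp: image_iff)
  qed (use D in auto)
  from additive_tagged_division_1[OF \<open>a \<le> b\<close> this, of F]
  show ?thesis
    by (simp add: sum.reindex[OF inj] o_def)
qed

text \<open>
  This identity lets the smallness condition of absolute continuity be phrased through the
  Lebesgue measure of the union, which is monotone and subadditive, instead of through sums of
  lengths.
\<close>

lemma division_measure:
  fixes S :: "real set"
  assumes D: "D division_of S"
  shows "S \<in> lmeasurable" "measure lebesgue S = (\<Sum>K\<in>D. Sup K - Inf K)"
proof -
  have K: "\<exists>u v. K = {u..v} \<and> u \<le> v" if "K \<in> D" for K
    using division_ofD(3,4)[OF D that] by (metis atLeastatMost_empty_iff box_real(2))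
  have fin: "finite D" using D by blast
  have lm: "K \<in> lmeasurable" if "K \<in> D" for K
    using K[OF that] by auto
  have S: "S = \<Union>D" using D by blast
  show "S \<in> lmeasurable"
    unfolding S using fin lm by (intro fmeasurable.finite_Union) auto
  have "measure lebesgue (\<Union>D) = (\<Sum>K\<in>D. measure lebesgue K)"
  proof (rule measure_negligible_finite_Union[OF fin lm])
    show "pairwise (\<lambda>S T. negligible (S \<inter> T)) D"
    proof (clarsimp simp: pairwise_def)
      fix A B assume AB: "A \<in> D" "B \<in> D" "A \<noteq> B"
      then have "interior A \<inter> interior B = {}"
        using division_ofD(5)[OF D] by blast
      moreover have "convex (A \<inter> B)"
        using K[OF AB(1)] K[OF AB(2)] by (auto intro!: convex_Int)
      ultimately show "negligible (A \<inter> B)"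
        by (simp add: negligible_convex_interior)
    qed
  qed
  also have "\<dots> = (\<Sum>K\<in>D. Sup K - Inf K)"
  proof (rule sum.cong)
    fix J assume "J \<in> D"
    then obtain u v where "J = {u..v}" "u \<le> v" using K by blast
    then show "measure lebesgue J = Sup J - Inf J" by simp
  qed simp
  finally show "measure lebesgue S = (\<Sum>K\<in>D. Sup K - Inf K)"
    by (simp add: S)
qed

text \<open>
  The Vitali covering theorem gives countably many disjoint intervals of the family that cover
  \<open>S\<close> up to a null set; finitely many of them already carry all but \<open>e\<close> of the total length.
  The intervals stay inside the open set \<open>U\<close>, because the fine family may be thinned to those
  contained in \<open>U\<close>. The set \<open>S\<close> may be non-measurable, hence the explicit measurable remainder
  \<open>T\<close>.
\<close>

lemma Vitali_finite_division:
  fixes S U :: "real set" and P :: "real \<Rightarrow> real \<Rightarrow> bool"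
  assumes "open U" "U \<in> lmeasurable" "S \<subseteq> U" "e > 0"
    and fine: "\<And>x d. x \<in> S \<Longrightarrow> d > 0 \<Longrightarrow> \<exists>a b. a < b \<and> b - a < d \<and> x \<in> {a..b} \<and> P a b"
  obtains D T where "D division_of \<Union>D" "pairwise disjnt D"
    "\<And>K. K \<in> D \<Longrightarrow> \<exists>a b. K = {a..b} \<and> a < b \<and> P a b"
    "\<Union>D \<subseteq> U" "S \<subseteq> \<Union>D \<union> T" "T \<in> lmeasurable" "measure lebesgue T < e"
proof -
  define K where "K = {(a, b). a < b \<and> P a b \<and> {a..b} \<subseteq> U}"
  define cen where "cen = (\<lambda>(a::real, b). (a + b) / 2)"
  define rad where "rad = (\<lambda>(a::real, b). (b - a) / 2)"
  define I where "I = (\<lambda>(a::real, b). {a..b})"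
  have cball: "cball (cen i) (rad i) = I i" for i
    by (auto simp: cen_def rad_def I_def cball_eq_atLeastAtMost field_simps split: prod.splits)
  obtain C where C: "countable C" "C \<subseteq> K"
     "pairwise (\<lambda>i j. disjnt (I i) (I j)) C" "negligible (S - (\<Union>i\<in>C. I i))"
  proof (rule Vitali_covering_theorem_cballs[of K rad S cen])
    show "0 < rad i" if "i \<in> K" for i
      using that by (auto simp: K_def rad_def)
    show "\<exists>i. i \<in> K \<and> x \<in> cball (cen i) (rad i) \<and> rad i < d" if x: "x \<in> S" and d: "0 < d" for x d
    proof -
      obtain r where r: "r > 0" "ball x r \<subseteq> U"
        using x \<open>open U\<close> \<open>S \<subseteq> U\<close> open_contains_ball by blast
      obtain a b where ab: "a < b" "b - a < min d r" "x \<in> {a..b}" "P a b"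
        using fine[OF x, of "min d r"] d r by auto
      have "{a..b} \<subseteq> ball x r"
        using ab by (auto simp: dist_real_def)
      then have "(a, b) \<in> K" using ab r by (auto simp: K_def)
      moreover have "x \<in> cball (cen (a, b)) (rad (a, b))"
        unfolding cball using ab by (simp add: I_def)
      moreover have "rad (a, b) < d" using ab by (simp add: rad_def)
      ultimately show ?thesis by blast
    qed
  qed (auto simp: cball)
  define A where "A = (\<Union>i\<in>C. I i)"
  have I_meas: "I i \<in> sets lebesgue" for i by (auto simp: I_def split: prod.splits)
  have A_sub: "A \<subseteq> U" using C(2) by (auto simp: A_def K_def I_def)
  have A_lm: "A \<in> lmeasurable"
    using A_sub \<open>U \<in> lmeasurable\<close> C(1) I_meas unfolding A_def
    by (intro fmeasurableI2[OF \<open>U \<in> lmeasurable\<close>]) auto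
  define C' where "C' n = {i \<in> C. to_nat_on C i < n}" for n
  define B where "B n = (\<Union>i\<in>C' n. I i)" for n
  have C'_fin: "finite (C' n)" for n
  proof (rule finite_imageD)
    show "finite (to_nat_on C ` C' n)"
      by (rule finite_subset[of _ "{..<n}"]) (auto simp: C'_def)
    show "inj_on (to_nat_on C) (C' n)"
      using inj_on_to_nat_on[OF C(1)] by (rule inj_on_subset) (auto simp: C'_def)
  qed
  have B_UN: "(\<Union>n. B n) = A"
    by (auto simp: A_def B_def C'_def)
  have B_meas: "B n \<in> sets lebesgue" for n
    using C'_fin I_meas by (auto simp: B_def)
  have "(\<lambda>n. measure lebesgue (B n)) \<longlonglongrightarrow> measure lebesgue (\<Union>n. B n)"
  proof (rule Lim_measure_incseq)
    show "range B \<subseteq> sets lebesgue" using B_meas by auto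
    show "incseq B" by (fastforce simp: incseq_def B_def C'_def)
    show "emeasure lebesgue (\<Union>n. B n) \<noteq> \<infinity>" using fmeasurableD2[OF A_lm] by (simp add: B_UN)
  qed
  then have "\<forall>\<^sub>F n in sequentially. measure lebesgue (B n) > measure lebesgue A - e"
    using \<open>e > 0\<close> by (intro order_tendstoD) (auto simp: B_UN)
  then obtain n where n: "measure lebesgue (B n) > measure lebesgue A - e"
    by (auto simp: eventually_sequentially)
  define D where "D = I ` C' n"
  define T where "T = (S - A) \<union> (A - B n)"
  have neg: "S - A \<in> null_sets lebesgue"
    using C(4) by (simp add: A_def negligible_iff_null_sets)
  have AB: "A - B n \<in> lmeasurable"
    by (rule fmeasurableI2[OF A_lm]) (use A_lm B_meas in auto)
  have UD: "\<Union>D = B n" by (simp add: D_def B_def)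
  have BA: "B n \<subseteq> A" using B_UN by auto
  have ID: "\<exists>a b. J = {a..b} \<and> a < b \<and> P a b" if "J \<in> D" for J
    using that C(2) by (force simp: D_def K_def I_def C'_def)
  have dis: "pairwise disjnt D"
    using C(3) by (auto simp: pairwise_def D_def C'_def)
  show ?thesis
  proof (rule that[of D T])
    show "D division_of \<Union>D"
    proof (rule division_ofI)
      show "finite D" using C'_fin by (simp add: D_def)
      fix J assume J: "J \<in> D"
      show "J \<noteq> {}" "\<exists>a b. J = cbox a b" using ID[OF J] by auto
      fix J' assume "J' \<in> D" "J \<noteq> J'"
      then have "J \<inter> J' = {}" using dis J by (auto simp: pairwise_def disjnt_def)
      then show "interior J \<inter> interior J' = {}"
        using interior_subset[of J] interior_subset[of J'] by blast
    qed auto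
    show "S \<subseteq> \<Union>D \<union> T" by (auto simp: UD T_def)
    show "\<Union>D \<subseteq> U" using UD BA A_sub by auto
    have "S - A \<in> lmeasurable" using neg by (simp add: null_sets_def fmeasurable_def)
    then show "T \<in> lmeasurable" using AB by (simp add: T_def fmeasurable.Un)
    have "measure lebesgue T = measure lebesgue (A - B n)"
      using measure_Un_null_set[OF fmeasurableD[OF AB] neg] by (simp add: T_def Un_commute)
    also have "\<dots> = measure lebesgue A - measure lebesgue (B n)"
      by (rule measurable_measure_Diff[OF A_lm B_meas BA])
    finally show "measure lebesgue T < e" using n by simp
  qed (use ID dis in auto)
qed

text \<open>
  Each interval of \<open>D\<close> is subdivided further by the intervals of \<open>D'\<close> that it contains; \<open>G\<close>
  collects the gaps. One and the same \<open>G\<close> has to serve for all \<open>F\<close>: the choice \<open>F x = x\<close>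
  controls the length of the gaps, and then absolute continuity controls the increments of the
  function of interest over them.
\<close>

lemma division_complement:
  fixes D D' :: "real set set"
  assumes D: "D division_of \<Union>D" "pairwise disjnt D"
    and D': "D' division_of \<Union>D'"
    and sub: "\<And>J. J \<in> D' \<Longrightarrow> \<exists>I\<in>D. J \<subseteq> I"
  obtains G where "G division_of \<Union>G" "\<Union>G \<subseteq> \<Union>D"
    "\<And>F :: real \<Rightarrow> real. (\<Sum>K\<in>D. F (Sup K) - F (Inf K)) =
      (\<Sum>K\<in>D'. F (Sup K) - F (Inf K)) + (\<Sum>K\<in>G. F (Sup K) - F (Inf K))"
proof -
  define part where "part I = {J \<in> D'. J \<subseteq> I}" for I
  have ex: "\<exists>q. part I \<subseteq> q \<and> q division_of I" if I: "I \<in> D" for I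
  proof -
    obtain a b where ab: "I = cbox a b"
      using division_ofD(4)[OF D(1) I] by blast
    have "part I division_of \<Union>(part I)"
      using division_of_subset[OF D'] by (auto simp: part_def)
    moreover have "\<Union>(part I) \<subseteq> cbox a b"
      by (auto simp: part_def ab)
    ultimately show ?thesis
      using partial_division_extend_interval ab by metis
  qed
  then obtain q where q: "\<And>I. I \<in> D \<Longrightarrow> part I \<subseteq> q I" "\<And>I. I \<in> D \<Longrightarrow> q I division_of I"
    by metis
  define R where "R I = q I - part I" for I
  have fin: "finite D" "finite D'" "\<And>I. I \<in> D \<Longrightarrow> finite (q I)"
    using D D' q(2) by auto
  have subI: "K \<subseteq> I" "K \<noteq> {}" if "I \<in> D" "K \<in> q I" for I K
    using division_ofD(2,3)[OF q(2)] that by blast+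
  have disjq: "q I \<inter> q I' = {}" if "I \<in> D" "I' \<in> D" "I \<noteq> I'" for I I'
  proof (rule equals0I)
    fix K assume K: "K \<in> q I \<inter> q I'"
    moreover have "I \<inter> I' = {}"
      using that D(2) by (auto simp: pairwise_def disjnt_def)
    ultimately show False
      using subI[OF that(1), of K] subI[OF that(2), of K] by blast
  qed
  have D'_eq: "D' = (\<Union>I\<in>D. part I)"
    using sub by (auto simp: part_def)
  define G where "G = (\<Union>I\<in>D. R I)"
  show ?thesis
  proof (rule that[of G])
    show "G division_of \<Union>G"
    proof (rule division_ofI)
      show "finite G" using fin by (auto simp: G_def R_def)
      fix K assume "K \<in> G"
      then obtain I where I: "I \<in> D" "K \<in> q I" by (auto simp: G_def R_def)
      show "K \<noteq> {}" "\<exists>a b. K = cbox a b"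
        using division_ofD(3,4)[OF q(2)[OF I(1)]] I by blast+
      fix K' assume "K' \<in> G" "K \<noteq> K'"
      then obtain I' where I': "I' \<in> D" "K' \<in> q I'" by (auto simp: G_def R_def)
      show "interior K \<inter> interior K' = {}"
      proof (cases "I = I'")
        case True
        then show ?thesis
          using division_ofD(5)[OF q(2)[OF I(1)]] I I' \<open>K \<noteq> K'\<close> by blast
      next
        case False
        then have "I \<inter> I' = {}" using D(2) I I' by (auto simp: pairwise_def disjnt_def)
        then show ?thesis
          using subI[OF I] subI[OF I'] interior_subset[of K] interior_subset[of K'] by blast
      qed
    qed auto
    show "\<Union>G \<subseteq> \<Union>D" using subI by (fastforce simp: G_def R_def)
  next
    fix F :: "real \<Rightarrow> real"
    let ?d = "\<lambda>K. F (Sup K) - F (Inf K)"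
    have tele: "?d I = sum ?d (q I)" if I: "I \<in> D" for I
    proof -
      obtain a b where ab: "I = {a..b}" "a \<le> b"
        using division_ofD(3,4)[OF D(1) I] by (metis atLeastatMost_empty_iff box_real(2))
      then show ?thesis
        using division_telescope[of "q I" a b F] q(2)[OF I] by simp
    qed
    have "sum ?d D = (\<Sum>I\<in>D. sum ?d (part I) + sum ?d (R I))"
    proof (rule sum.cong)
      fix I assume "I \<in> D"
      then show "?d I = sum ?d (part I) + sum ?d (R I)"
        unfolding tele[OF \<open>I \<in> D\<close>] R_def
        using sum.subset_diff[OF q(1) fin(3)] by (simp add: add.commute)
    qed simp
    also have "\<dots> = (\<Sum>I\<in>D. sum ?d (part I)) + (\<Sum>I\<in>D. sum ?d (R I))"
      by (simp add: sum.distrib)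
    also have "(\<Sum>I\<in>D. sum ?d (part I)) = sum ?d D'"
      unfolding D'_eq
    proof (rule sum.UNION_disjoint[symmetric])
      show "\<forall>I\<in>D. finite (part I)" using fin q(1) finite_subset by blast
      show "\<forall>I\<in>D. \<forall>I'\<in>D. I \<noteq> I' \<longrightarrow> part I \<inter> part I' = {}" using q(1) disjq by blast
    qed (rule fin)
    also have "(\<Sum>I\<in>D. sum ?d (R I)) = sum ?d G"
      unfolding G_def
    proof (rule sum.UNION_disjoint[symmetric])
      show "\<forall>I\<in>D. finite (R I)" using fin by (simp add: R_def)
      show "\<forall>I\<in>D. \<forall>I'\<in>D. I \<noteq> I' \<longrightarrow> R I \<inter> R I' = {}" using disjq unfolding R_def by blast
    qed (rule fin)
    finally show "sum ?d D = sum ?d D' + sum ?d G" .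
  qed
qed

section \<open>Absolutely continuous functions are differentiable almost everywhere\<close>

text \<open>
  \<open>abs_cont_on {0..1}\<close> for functions with values in any normed space, with the length of the
  family expressed as a measure. The general codomain is needed because differentiability is
  proved for real and imaginary parts.
\<close>

definition abs_continuous :: "(real \<Rightarrow> 'a::real_normed_vector) \<Rightarrow> bool" where
  "abs_continuous F \<longleftrightarrow>
     (\<forall>\<epsilon>>0. \<exists>\<delta>>0. \<forall>D. D division_of \<Union>D \<longrightarrow> \<Union>D \<subseteq> {0..1} \<longrightarrow> measure lebesgue (\<Union>D) < \<delta> \<longrightarrow>
        (\<Sum>K\<in>D. norm (F (Sup K) - F (Inf K))) < \<epsilon>)"

lemma abs_continuousE:
  assumes "abs_continuous F" "\<epsilon> > 0"
  obtains \<delta> where "\<delta> > 0" "\<And>D. D division_of \<Union>D \<Longrightarrow> \<Union>D \<subseteq> {0..1} \<Longrightarrow> measure lebesgue (\<Union>D) < \<delta> \<Longrightarrow>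
        (\<Sum>K\<in>D. norm (F (Sup K) - F (Inf K))) < \<epsilon>"
  using assms unfolding abs_continuous_def by metis

lemma abs_cont_on_iff_abs_continuous: "abs_cont_on {0..1} f \<longleftrightarrow> abs_continuous f"
proof -
  have "(D division_of \<Union>D \<and> \<Union>D \<subseteq> {0..1} \<and> (\<Sum>K\<in>D. Sup K - Inf K) < \<delta> \<longrightarrow> X) \<longleftrightarrow>
    (D division_of \<Union>D \<longrightarrow> \<Union>D \<subseteq> {0..1} \<longrightarrow> measure lebesgue (\<Union>D) < \<delta> \<longrightarrow> X)"
    for D :: "real set set" and \<delta> X
    using division_measure(2)[of D "\<Union>D"] by auto
  then show ?thesis
    unfolding abs_cont_on_def abs_continuous_def by simp
qed

definition slope :: "(real \<Rightarrow> real) \<Rightarrow> real \<Rightarrow> real \<Rightarrow> real" where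
  "slope F x y = (F y - F x) / (y - x)"

text \<open>
  A point need not be the centre of the small intervals used in a Vitali cover, so one-sided
  difference quotients can be used, with \<open>x\<close> as the left or the right endpoint.
\<close>

lemma frequently_slope_interval:
  assumes fr: "\<exists>\<^sub>F y in at x. P (slope F x y)" and "d > 0"
  shows "\<exists>a b. a < b \<and> b - a < d \<and> x \<in> {a..b} \<and> P ((F b - F a) / (b - a))"
proof -
  obtain y where y: "y \<noteq> x" "dist y x < d" "P (slope F x y)"
    using fr \<open>d > 0\<close> unfolding frequently_at by auto
  have "slope F x y = (F x - F y) / (x - y)"
    using y by (simp add: slope_def field_simps)
  then show ?thesis
    using y unfolding slope_def dist_real_def
    by (cases "x < y") (rule exI[of _ x], rule exI[of _ y], simp, rule exI[of _ y], rule exI[of _ x], simp)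
qed

text \<open>
  On a piece shorter than the \<open>\<delta>\<close> belonging to \<open>\<epsilon> = 1\<close>, a disjoint family of intervals with
  slopes above \<open>2 / e\<close> in absolute value has total increment less than \<open>1\<close> and therefore total
  length less than \<open>e / 2\<close>. By the Vitali covering argument such families exhaust the
  exceptional set.
\<close>

lemma negligible_unbounded_slopes:
  assumes F: "abs_continuous F"
  shows "negligible {x \<in> {0<..<1}. \<forall>q. \<exists>\<^sub>F y in at x. \<bar>slope F x y\<bar> > q}" (is "negligible ?E")
proof -
  obtain \<delta> where \<delta>: "\<delta> > 0" "\<And>D. D division_of \<Union>D \<Longrightarrow> \<Union>D \<subseteq> {0..1} \<Longrightarrow> measure lebesgue (\<Union>D) < \<delta> \<Longrightarrow>
        (\<Sum>K\<in>D. norm (F (Sup K) - F (Inf K))) < 1"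
    using abs_continuousE[OF F zero_less_one] by blast
  have local: "negligible (?E \<inter> {z - \<delta>/4<..<z + \<delta>/4})" for z
    unfolding negligible_outer_le
  proof (intro allI impI)
    fix e :: real assume e: "e > 0"
    define U where "U = {0<..<1} \<inter> {z - \<delta>/4<..<z + \<delta>/4}"
    have U: "open U" "U \<in> lmeasurable"
      by (auto simp: U_def open_Int intro!: fmeasurable.Int)
    have "measure lebesgue U \<le> measure lebesgue {z - \<delta>/4<..<z + \<delta>/4}"
      using U by (intro measure_mono_fmeasurable) (auto simp: U_def)
    also have "\<dots> < \<delta>" using \<delta> by simp
    finally have mU: "measure lebesgue U < \<delta>" .
    obtain D T where DT: "D division_of \<Union>D"
      "\<And>K. K \<in> D \<Longrightarrow> \<exists>a b. K = {a..b} \<and> a < b \<and> \<bar>(F b - F a) / (b - a)\<bar> > 2 / e"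
      "\<Union>D \<subseteq> U" "?E \<inter> U \<subseteq> \<Union>D \<union> T" "T \<in> lmeasurable" "measure lebesgue T < e / 2"
    proof (rule Vitali_finite_division[OF U, of "?E \<inter> U" "e / 2" "\<lambda>a b. \<bar>(F b - F a) / (b - a)\<bar> > 2 / e"])
      show "\<exists>a b. a < b \<and> b - a < d \<and> x \<in> {a..b} \<and> \<bar>(F b - F a) / (b - a)\<bar> > 2 / e"
        if "x \<in> ?E \<inter> U" "d > 0" for x d
        using that by (intro frequently_slope_interval[where P = "\<lambda>s. \<bar>s\<bar> > 2 / e"]) auto
    qed (use e in auto)
    have lmD: "\<Union>D \<in> lmeasurable" using division_measure[OF DT(1)] by simp
    have "measure lebesgue (\<Union>D) \<le> measure lebesgue U"
      using DT(3) U lmD by (intro measure_mono_fmeasurable) auto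
    then have "(\<Sum>K\<in>D. norm (F (Sup K) - F (Inf K))) < 1"
      using DT(3) mU by (intro \<delta>(2) DT) (auto simp: U_def)
    moreover have "2 / e * measure lebesgue (\<Union>D) \<le> (\<Sum>K\<in>D. norm (F (Sup K) - F (Inf K)))"
      unfolding division_measure(2)[OF DT(1)] sum_distrib_left
    proof (rule sum_mono)
      fix K assume "K \<in> D"
      then obtain a b where "K = {a..b}" "a < b" "\<bar>(F b - F a) / (b - a)\<bar> > 2 / e"
        using DT(2) by blast
      then show "2 / e * (Sup K - Inf K) \<le> norm (F (Sup K) - F (Inf K))"
        by (simp add: pos_less_divide_eq)
    qed
    ultimately have "2 / e * measure lebesgue (\<Union>D) < 1" by linarith
    then have mD: "measure lebesgue (\<Union>D) < e / 2" using e by (simp add: field_simps)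
    have "measure lebesgue (\<Union>D \<union> T) \<le> measure lebesgue (\<Union>D) + measure lebesgue T"
      using lmD DT(5) by (intro measure_Un_le) auto
    then have "measure lebesgue (\<Union>D \<union> T) \<le> e" using mD DT(6) by linarith
    moreover have "?E \<inter> {z - \<delta>/4<..<z + \<delta>/4} \<subseteq> \<Union>D \<union> T" using DT(4) by (auto simp: U_def)
    ultimately show "\<exists>T. ?E \<inter> {z - \<delta>/4<..<z + \<delta>/4} \<subseteq> T \<and> T \<in> lmeasurable \<and> measure lebesgue T \<le> e"
      using lmD DT(5) by blast
  qed
  show ?thesis
    unfolding locally_negligible_alt[of ?E]
  proof (intro ballI exI conjI)
    fix z assume "z \<in> ?E"
    show "openin (top_of_set ?E) (?E \<inter> {z - \<delta>/4<..<z + \<delta>/4})"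
      by (intro openin_open_Int) auto
    show "z \<in> ?E \<inter> {z - \<delta>/4<..<z + \<delta>/4}" using \<open>z \<in> ?E\<close> \<delta>(1) by auto
    show "negligible (?E \<inter> {z - \<delta>/4<..<z + \<delta>/4})" by (rule local)
  qed
qed

text \<open>
  If the exceptional set \<open>E\<close> had outer measure \<open>m > 0\<close>, take an open \<open>U \<supseteq> E\<close> of measure close
  to \<open>m\<close>. A Vitali family \<open>A\<close> in \<open>U\<close> with slopes above \<open>q\<close> covers almost all of \<open>E\<close>, and
  inside it a second family \<open>B\<close> with slopes below \<open>p\<close> does so as well. The gaps of \<open>B\<close> in \<open>A\<close>
  have small length, so by absolute continuity they carry only a small increment; hence the
  same increment of \<open>F\<close> is at least about \<open>q m\<close> and at most about \<open>p m\<close>, a contradiction.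
\<close>

lemma negligible_slope_gap:
  assumes F: "abs_continuous F" and pq: "p < q"
  shows "negligible {x \<in> {0<..<1}. (\<exists>\<^sub>F y in at x. slope F x y < p) \<and> (\<exists>\<^sub>F y in at x. slope F x y > q)}"
    (is "negligible ?E")
proof (rule ccontr)
  assume "\<not> ?thesis"
  then obtain c where c: "c > 0" "\<And>T. ?E \<subseteq> T \<Longrightarrow> T \<in> lmeasurable \<Longrightarrow> measure lebesgue T > c"
    unfolding negligible_outer_le by force
  define \<M> where "\<M> = {measure lebesgue T | T. ?E \<subseteq> T \<and> T \<in> lmeasurable}"
  define m where "m = Inf \<M>"
  have "measure lebesgue {0<..<1::real} \<in> \<M>" unfolding \<M>_def by (auto intro!: exI[of _ "{0<..<1::real}"])
  then have ne: "\<M> \<noteq> {}" by auto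
  have bdd: "bdd_below \<M>" unfolding \<M>_def bdd_below_def by (auto intro!: exI[of _ 0])
  have m_le: "m \<le> measure lebesgue T" if "?E \<subseteq> T" "T \<in> lmeasurable" for T
    unfolding m_def using that by (intro cInf_lower bdd) (auto simp: \<M>_def)
  have mc: "m \<ge> c" unfolding m_def using ne c(2) by (intro cInf_greatest) (auto simp: \<M>_def less_imp_le)
  obtain \<delta> where \<delta>: "\<delta> > 0" "\<And>D. D division_of \<Union>D \<Longrightarrow> \<Union>D \<subseteq> {0..1} \<Longrightarrow> measure lebesgue (\<Union>D) < \<delta> \<Longrightarrow>
        (\<Sum>K\<in>D. norm (F (Sup K) - F (Inf K))) < (q - p) * c / 4"
  proof (rule abs_continuousE[OF F])
    show "(q - p) * c / 4 > 0" using pq c by simp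
  qed blast
  \<comment> \<open>The three bounds make the gaps shorter than \<open>\<delta>\<close>, keep \<open>B\<close> at least \<open>3 c / 4\<close> long,
    and make the contribution of the slope \<open>q\<close> on the gaps at most \<open>(q - p) c / 4\<close>.\<close>
  define \<eta> where "\<eta> = Min {\<delta> / 4, c / 8, (q - p) * c / (12 * (\<bar>q\<bar> + 1))}"
  have \<eta>: "\<eta> > 0"
    using \<delta>(1) pq c(1) by (auto simp: \<eta>_def intro!: divide_pos_pos mult_pos_pos)
  have \<eta>_le: "\<eta> \<le> \<delta> / 4" "\<eta> \<le> c / 8" "\<eta> \<le> (q - p) * c / (12 * (\<bar>q\<bar> + 1))"
    unfolding \<eta>_def by (rule Min_le; simp)+
  note \<eta> = \<eta> \<eta>_le
  obtain T0 where T0: "?E \<subseteq> T0" "T0 \<in> lmeasurable" "measure lebesgue T0 < m + \<eta> / 2"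
  proof -
    have "Inf \<M> < m + \<eta> / 2" using \<eta>(1) by (simp add: m_def)
    then show ?thesis using that cInf_lessD[OF ne] by (auto simp: \<M>_def)
  qed
  obtain W where W: "open W" "T0 \<subseteq> W" "W - T0 \<in> lmeasurable" "emeasure lebesgue (W - T0) < ennreal (\<eta> / 2)"
    using sets_lebesgue_outer_open[of T0 "\<eta> / 2"] T0(2) \<eta>(1) by (auto simp: fmeasurableD)
  have mW: "measure lebesgue (W - T0) < \<eta> / 2"
    using W(3,4) by (metis emeasure_eq_measure2 ennreal_less_iff measure_nonneg)
  have W_lm: "W \<in> lmeasurable"
    using W(2,3) T0(2) by (metis Diff_partition fmeasurable.Un)
  have W_m: "measure lebesgue W < m + \<eta>"
  proof -
    have "measure lebesgue (T0 \<union> (W - T0)) \<le> measure lebesgue T0 + measure lebesgue (W - T0)"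
      using T0 W by (intro measure_Un_le) auto
    then show ?thesis using T0(3) mW W(2) by (simp add: Un_absorb1)
  qed
  define U where "U = W \<inter> {0<..<1}"
  have U: "open U" "U \<in> lmeasurable" "?E \<subseteq> U"
    using W W_lm T0 by (auto simp: U_def intro!: fmeasurable.Int)
  have U_m: "measure lebesgue U < m + \<eta>"
  proof -
    have "measure lebesgue U \<le> measure lebesgue W"
      using U W_lm by (intro measure_mono_fmeasurable) (auto simp: U_def)
    then show ?thesis using W_m by linarith
  qed
  obtain A S where A: "A division_of \<Union>A" "pairwise disjnt A"
      "\<And>K. K \<in> A \<Longrightarrow> \<exists>a b. K = {a..b} \<and> a < b \<and> (F b - F a) / (b - a) > q"
      "\<Union>A \<subseteq> U" "?E \<subseteq> \<Union>A \<union> S" "S \<in> lmeasurable" "measure lebesgue S < \<eta>"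
  proof (rule Vitali_finite_division[OF U(1,2), of "?E" "\<eta>" "\<lambda>a b. (F b - F a) / (b - a) > q"])
    show "\<exists>a b. a < b \<and> b - a < d \<and> x \<in> {a..b} \<and> (F b - F a) / (b - a) > q"
      if "x \<in> ?E" "d > 0" for x d
      using that by (intro frequently_slope_interval[where P = "\<lambda>s. s > q"]) auto
  qed (use \<eta> U in auto)
  \<comment> \<open>The second covering takes place in the interiors of the intervals of \<open>A\<close>, so that each of
    its intervals lies in a single interval of \<open>A\<close>; only finitely many endpoints are lost.\<close>
  define V where "V = (\<Union>I\<in>A. interior I)"
  have V: "open V" by (auto simp: V_def)
  have A_lm: "\<Union>A \<in> lmeasurable" using division_measure[OF A(1)] by simp
  have "V \<subseteq> \<Union>A" using interior_subset by (fastforce simp: V_def)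
  then have V_lm: "V \<in> lmeasurable"
    using fmeasurableI2[OF A_lm] V by auto
  obtain B S' where B: "B division_of \<Union>B" "pairwise disjnt B"
      "\<And>K. K \<in> B \<Longrightarrow> \<exists>a b. K = {a..b} \<and> a < b \<and> (F b - F a) / (b - a) < p \<and> (\<exists>I\<in>A. {a..b} \<subseteq> I)"
      "\<Union>B \<subseteq> V" "?E \<inter> V \<subseteq> \<Union>B \<union> S'" "S' \<in> lmeasurable" "measure lebesgue S' < \<eta>"
  proof (rule Vitali_finite_division[OF V(1) V_lm, of "?E \<inter> V" "\<eta>"
        "\<lambda>a b. (F b - F a) / (b - a) < p \<and> (\<exists>I\<in>A. {a..b} \<subseteq> I)"])
    fix x d assume x: "x \<in> ?E \<inter> V" and d: "(d::real) > 0"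
    obtain I where I: "I \<in> A" "x \<in> interior I" using x by (auto simp: V_def)
    obtain r where r: "r > 0" "ball x r \<subseteq> I"
      using I(2) by (auto simp: mem_interior)
    obtain a b where ab: "a < b" "b - a < min d r" "x \<in> {a..b}" "(F b - F a) / (b - a) < p"
      using frequently_slope_interval[where P = "\<lambda>s. s < p" and F = F and x = x and d = "min d r"] x d r(1) by auto
    have "{a..b} \<subseteq> ball x r" using ab by (auto simp: dist_real_def)
    then show "\<exists>a b. a < b \<and> b - a < d \<and> x \<in> {a..b} \<and> (F b - F a) / (b - a) < p \<and> (\<exists>I\<in>A. {a..b} \<subseteq> I)"
      using ab r I by (intro exI[of _ a] exI[of _ b]) auto
  qed (use \<eta> in auto)
  have B_lm: "\<Union>B \<in> lmeasurable" using division_measure[OF B(1)] by simp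
  obtain G where G: "G division_of \<Union>G" "\<Union>G \<subseteq> \<Union>A"
    "\<And>F :: real \<Rightarrow> real. (\<Sum>K\<in>A. F (Sup K) - F (Inf K)) =
      (\<Sum>K\<in>B. F (Sup K) - F (Inf K)) + (\<Sum>K\<in>G. F (Sup K) - F (Inf K))"
  proof (rule division_complement[OF A(1,2) B(1)])
    show "\<exists>I\<in>A. J \<subseteq> I" if "J \<in> B" for J using B(3)[OF that] by blast
  qed (rule that, assumption+)
  define a where "a = measure lebesgue (\<Union>A)"
  define b where "b = measure lebesgue (\<Union>B)"
  define g where "g = measure lebesgue (\<Union>G)"
  have abg: "a = b + g"
    using G(3)[of "\<lambda>x. x"] division_measure(2)[OF A(1)] division_measure(2)[OF B(1)] division_measure(2)[OF G(1)]
    by (simp add: a_def b_def g_def)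
  have a_le: "a < m + \<eta>"
  proof -
    have "a \<le> measure lebesgue U"
      using A(4) A_lm U unfolding a_def by (intro measure_mono_fmeasurable) auto
    then show ?thesis using U_m by linarith
  qed
  define N where "N = (\<Union>I\<in>A. I - interior I)"
  have "negligible N"
  proof -
    have "negligible (I - interior I)" if "I \<in> A" for I
    proof -
      obtain u v where "I = {u..v}" using A(3)[OF \<open>I \<in> A\<close>] by blast
      then have "I - interior I \<subseteq> {u, v}" by auto
      then show ?thesis by (meson finite.emptyI finite_insert negligible_finite negligible_subset)
    qed
    then show ?thesis unfolding N_def using A(1) by (intro negligible_Union) auto
  qed
  have b_ge: "m \<le> b + 2 * \<eta>"
  proof -
    have N: "N \<in> lmeasurable" "measure lebesgue N = 0"
      using \<open>negligible N\<close> by (auto simp: negligible_imp_measurable negligible_imp_measure0)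
    have "?E \<subseteq> \<Union>B \<union> S' \<union> S \<union> N"
    proof
      fix x assume x: "x \<in> ?E"
      show "x \<in> \<Union>B \<union> S' \<union> S \<union> N"
      proof (cases "x \<in> V")
        case True
        then show ?thesis using x B(5) by blast
      next
        case False
        then have "x \<in> N" if "I \<in> A" "x \<in> I" for I using that unfolding N_def V_def by blast
        then show ?thesis using x A(5) by blast
      qed
    qed
    then have "m \<le> measure lebesgue (\<Union>B \<union> S' \<union> S \<union> N)"
      using B_lm A B N by (intro m_le) auto
    also have "\<dots> \<le> b + measure lebesgue S' + measure lebesgue S + measure lebesgue N"
      unfolding b_def using B_lm A(6) B(6) N
      by (intro order_trans[OF measure_Un_le] add_mono order_refl) (auto intro: fmeasurableD)
    finally show ?thesis using A(7) B(7) N by simp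
  qed
  have g_le: "g < 3 * \<eta>" using abg a_le b_ge by linarith
  have "q * a \<le> (\<Sum>K\<in>A. F (Sup K) - F (Inf K))"
    unfolding a_def division_measure(2)[OF A(1)] sum_distrib_left
  proof (rule sum_mono)
    fix K assume "K \<in> A"
    then obtain a b where "K = {a..b}" "a < b" "(F b - F a) / (b - a) > q" using A(3) by blast
    then show "q * (Sup K - Inf K) \<le> F (Sup K) - F (Inf K)" by (simp add: pos_less_divide_eq)
  qed
  moreover have "(\<Sum>K\<in>B. F (Sup K) - F (Inf K)) \<le> p * b"
    unfolding b_def division_measure(2)[OF B(1)] sum_distrib_left
  proof (rule sum_mono)
    fix K assume "K \<in> B"
    then obtain a b where "K = {a..b}" "a < b" "(F b - F a) / (b - a) < p" using B(3) by blast
    then show "F (Sup K) - F (Inf K) \<le> p * (Sup K - Inf K)" by (simp add: pos_divide_less_eq)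
  qed
  moreover have "(\<Sum>K\<in>G. F (Sup K) - F (Inf K)) < (q - p) * c / 4"
  proof -
    have "\<Union>G \<subseteq> {0<..<1}" using subset_trans[OF G(2) A(4)] by (simp add: U_def)
    also have "\<dots> \<subseteq> {0..1}" by auto
    finally have "(\<Sum>K\<in>G. norm (F (Sup K) - F (Inf K))) < (q - p) * c / 4"
      using g_le \<eta> \<delta>(1) by (intro \<delta>(2) G) (auto simp: g_def)
    moreover have "(\<Sum>K\<in>G. F (Sup K) - F (Inf K)) \<le> (\<Sum>K\<in>G. norm (F (Sup K) - F (Inf K)))"
      by (intro sum_mono) simp
    ultimately show ?thesis by linarith
  qed
  ultimately have main: "q * b + q * g < p * b + (q - p) * c / 4"
    using G(3)[of F] abg by (simp only: distrib_left)
  have "\<bar>q\<bar> * g \<le> (q - p) * c / 4"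
  proof -
    have "\<bar>q\<bar> * g \<le> (\<bar>q\<bar> + 1) * (3 * \<eta>)"
      using g_le by (intro mult_mono) (auto simp: g_def)
    also have "\<dots> \<le> (\<bar>q\<bar> + 1) * (3 * ((q - p) * c / (12 * (\<bar>q\<bar> + 1))))"
      using \<eta>(4) by (intro mult_left_mono) auto
    also have "\<dots> = (q - p) * c / 4" by (simp add: field_simps)
    finally show ?thesis .
  qed
  moreover have "q * g \<ge> - (\<bar>q\<bar> * g)"
    by (metis abs_le_iff abs_mult abs_of_nonneg g_def measure_nonneg minus_le_iff order_refl)
  ultimately have "q * b < p * b + (q - p) * c / 2"
    using main by linarith
  then have "(q - p) * b < (q - p) * (c / 2)"
    by (simp only: left_diff_distrib times_divide_eq_right)
  then have "b < c / 2" using pq by (simp add: mult_less_cancel_left_pos)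
  moreover have "c * 3 / 4 \<le> b" using b_ge mc \<eta>(3) by linarith
  ultimately show False using c(1) by linarith
qed

text \<open>
  The candidate limit is the supremum of all values that \<open>g\<close> frequently exceeds. Only rational
  gaps have to be excluded, so that the exceptional sets of the application form a countable
  family.
\<close>

lemma tendsto_if_no_frequent_gap:
  fixes g :: "'a \<Rightarrow> real"
  assumes bdd: "\<not> (\<forall>q. \<exists>\<^sub>F y in X. \<bar>g y\<bar> > q)"
    and gap: "\<And>p q. p \<in> \<rat> \<Longrightarrow> q \<in> \<rat> \<Longrightarrow> p < q \<Longrightarrow> \<not> ((\<exists>\<^sub>F y in X. g y < p) \<and> (\<exists>\<^sub>F y in X. g y > q))"
    and X: "X \<noteq> bot"
  obtains L where "(g \<longlongrightarrow> L) X"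
proof -
  obtain M where M: "\<forall>\<^sub>F y in X. \<bar>g y\<bar> \<le> M"
    using bdd by (auto simp: not_frequently not_less)
  define S where "S = {c. \<exists>\<^sub>F y in X. g y > c}"
  have "- M - 1 \<in> S"
    unfolding S_def using M X
    by (auto intro!: eventually_frequently elim!: eventually_mono)
  moreover have up: "c \<le> M" if "c \<in> S" for c
  proof (rule ccontr)
    assume "\<not> c \<le> M"
    then have "\<forall>\<^sub>F y in X. \<not> g y > c" using M by (auto elim!: eventually_mono)
    then show False using that by (simp add: S_def frequently_def)
  qed
  ultimately have bddS: "bdd_above S" and neS: "S \<noteq> {}" by (auto simp: bdd_above_def)
  have "(g \<longlongrightarrow> Sup S) X"
  proof (rule order_tendstoI)
    fix a assume "a < Sup S"
    then obtain c where c: "c \<in> S" "a < c" using less_cSupE[OF _ neS] by blast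
    obtain p where p: "p \<in> \<rat>" "a < p" "p < c" using Rats_dense_in_real[OF c(2)] by blast
    obtain q where q: "q \<in> \<rat>" "p < q" "q < c" using Rats_dense_in_real[OF p(3)] by blast
    have "\<exists>\<^sub>F y in X. g y > q" using c q unfolding S_def by (auto elim!: frequently_elim1)
    then have "\<not> (\<exists>\<^sub>F y in X. g y < p)" using gap p q by blast
    then show "\<forall>\<^sub>F y in X. a < g y"
      unfolding not_frequently using p by (auto elim!: eventually_mono)
  next
    fix a assume a: "Sup S < a"
    define c where "c = (Sup S + a) / 2"
    have c: "c > Sup S" "c < a" using a by (auto simp: c_def)
    then have "c \<notin> S" using cSup_upper[OF _ bddS, of c] by auto
    then show "\<forall>\<^sub>F y in X. g y < a"
      unfolding S_def mem_Collect_eq not_frequently using c by (auto elim!: eventually_mono)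
  qed
  then show ?thesis using that by blast
qed

lemma abs_continuous_differentiable_ae_real:
  fixes F :: "real \<Rightarrow> real"
  assumes F: "abs_continuous F"
  obtains N where "negligible N" "\<And>x. x \<in> {0..1} - N \<Longrightarrow> F differentiable (at x)"
proof -
  define E where "E = {x \<in> {0<..<1}. \<forall>q. \<exists>\<^sub>F y in at x. \<bar>slope F x y\<bar> > q}"
  define H where "H = (\<lambda>(p, q). {x \<in> {0<..<1}. (\<exists>\<^sub>F y in at x. slope F x y < p) \<and> (\<exists>\<^sub>F y in at x. slope F x y > q)})"
  define I where "I = {(p, q) \<in> \<rat> \<times> \<rat>. p < (q::real)}"
  have "countable I"
    by (rule countable_subset[of _ "\<rat> \<times> \<rat>"]) (auto simp: I_def countable_rat)
  then have "negligible (\<Union>(H ` I))"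
    using negligible_slope_gap[OF F]
    by (intro negligible_countable_Union) (auto simp: H_def I_def)
  moreover have "negligible E"
    unfolding E_def by (rule negligible_unbounded_slopes[OF F])
  ultimately have neg: "negligible (E \<union> \<Union>(H ` I) \<union> {0, 1})"
    by (simp add: negligible_Un)
  show ?thesis
  proof (rule that[OF neg])
    fix x assume x: "x \<in> {0..1} - (E \<union> \<Union>(H ` I) \<union> {0, 1})"
    then have x01: "x \<in> {0<..<1}" by auto
    obtain L where "(slope F x \<longlongrightarrow> L) (at x)"
    proof (rule tendsto_if_no_frequent_gap[of "slope F x" "at x"])
      show "\<not> (\<forall>q. \<exists>\<^sub>F y in at x. q < \<bar>slope F x y\<bar>)" using x x01 by (auto simp: E_def)
      show "\<not> ((\<exists>\<^sub>F y in at x. slope F x y < p) \<and> (\<exists>\<^sub>F y in at x. slope F x y > q))"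
        if "p \<in> \<rat>" "q \<in> \<rat>" "p < q" for p q
        using x x01 that by (auto simp: H_def I_def)
    qed auto
    then have "(F has_field_derivative L) (at x)"
      by (simp add: has_field_derivative_iff slope_def[abs_def])
    then show "F differentiable (at x)"
      using real_differentiable_def by blast
  qed
qed

section \<open>The fundamental theorem of calculus for absolutely continuous functions\<close>

lemma abs_continuous_mono:
  assumes F: "abs_continuous F"
    and le: "\<And>x y. x \<in> {0..1} \<Longrightarrow> y \<in> {0..1} \<Longrightarrow> norm (G y - G x) \<le> norm (F y - F x)"
  shows "abs_continuous G"
  unfolding abs_continuous_def
proof (intro allI impI)
  fix \<epsilon> :: real assume "\<epsilon> > 0"
  then obtain \<delta> where \<delta>: "\<delta> > 0" "\<And>D. D division_of \<Union>D \<Longrightarrow> \<Union>D \<subseteq> {0..1} \<Longrightarrow> measure lebesgue (\<Union>D) < \<delta> \<Longrightarrow>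
        (\<Sum>K\<in>D. norm (F (Sup K) - F (Inf K))) < \<epsilon>"
    using abs_continuousE[OF F] by blast
  have "(\<Sum>K\<in>D. norm (G (Sup K) - G (Inf K))) < \<epsilon>"
    if D: "D division_of \<Union>D" "\<Union>D \<subseteq> {0..1}" "measure lebesgue (\<Union>D) < \<delta>" for D
  proof -
    have "(\<Sum>K\<in>D. norm (G (Sup K) - G (Inf K))) \<le> (\<Sum>K\<in>D. norm (F (Sup K) - F (Inf K)))"
      using endpoints_in_division[OF D(1)] D(2) by (intro sum_mono le) blast+
    then show ?thesis using \<delta>(2)[OF D] by linarith
  qed
  then show "\<exists>\<delta>>0. \<forall>D. D division_of \<Union>D \<longrightarrow> \<Union>D \<subseteq> {0..1} \<longrightarrow> measure lebesgue (\<Union>D) < \<delta> \<longrightarrow>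
        (\<Sum>K\<in>D. norm (G (Sup K) - G (Inf K))) < \<epsilon>"
    using \<delta>(1) by blast
qed

text \<open>
  A common source for sums, products and Lipschitz functions.
\<close>

lemma abs_continuous_combine:
  assumes F: "abs_continuous F" and G: "abs_continuous G" and "c > 0"
    and le: "\<And>x y. x \<in> {0..1} \<Longrightarrow> y \<in> {0..1} \<Longrightarrow>
      norm (H y - H x) \<le> c * norm (F y - F x) + c * norm (G y - G x)"
  shows "abs_continuous H"
  unfolding abs_continuous_def
proof (intro allI impI)
  fix \<epsilon> :: real assume "\<epsilon> > 0"
  then have \<epsilon>: "\<epsilon> / (2 * c) > 0" using \<open>c > 0\<close> by simp
  obtain \<delta> where \<delta>: "\<delta> > 0" "\<And>D. D division_of \<Union>D \<Longrightarrow> \<Union>D \<subseteq> {0..1} \<Longrightarrow> measure lebesgue (\<Union>D) < \<delta> \<Longrightarrow>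
        (\<Sum>K\<in>D. norm (F (Sup K) - F (Inf K))) < \<epsilon> / (2 * c)"
    using abs_continuousE[OF F \<epsilon>] by blast
  obtain \<delta>' where \<delta>': "\<delta>' > 0" "\<And>D. D division_of \<Union>D \<Longrightarrow> \<Union>D \<subseteq> {0..1} \<Longrightarrow> measure lebesgue (\<Union>D) < \<delta>' \<Longrightarrow>
        (\<Sum>K\<in>D. norm (G (Sup K) - G (Inf K))) < \<epsilon> / (2 * c)"
    using abs_continuousE[OF G \<epsilon>] by blast
  have "(\<Sum>K\<in>D. norm (H (Sup K) - H (Inf K))) < \<epsilon>"
    if D: "D division_of \<Union>D" "\<Union>D \<subseteq> {0..1}" "measure lebesgue (\<Union>D) < min \<delta> \<delta>'" for D
  proof -
    have "(\<Sum>K\<in>D. norm (H (Sup K) - H (Inf K))) \<le>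
      (\<Sum>K\<in>D. c * norm (F (Sup K) - F (Inf K)) + c * norm (G (Sup K) - G (Inf K)))"
      using endpoints_in_division[OF D(1)] D(2) by (intro sum_mono le) blast+
    also have "\<dots> = c * (\<Sum>K\<in>D. norm (F (Sup K) - F (Inf K))) + c * (\<Sum>K\<in>D. norm (G (Sup K) - G (Inf K)))"
      by (simp add: sum.distrib sum_distrib_left)
    also have "\<dots> < c * (\<epsilon> / (2 * c)) + c * (\<epsilon> / (2 * c))"
      using D \<open>c > 0\<close> by (intro add_strict_mono mult_strict_left_mono \<delta> \<delta>') auto
    also have "\<dots> = \<epsilon>" using \<open>c > 0\<close> by (simp add: field_simps)
    finally show ?thesis .
  qed
  then show "\<exists>\<delta>>0. \<forall>D. D division_of \<Union>D \<longrightarrow> \<Union>D \<subseteq> {0..1} \<longrightarrow> measure lebesgue (\<Union>D) < \<delta> \<longrightarrow>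
        (\<Sum>K\<in>D. norm (H (Sup K) - H (Inf K))) < \<epsilon>"
    using \<delta>(1) \<delta>'(1) by (intro exI[of _ "min \<delta> \<delta>'"]) simp
qed

lemma abs_continuous_ident: "abs_continuous (\<lambda>x::real. x)"
  unfolding abs_continuous_def
proof (intro allI impI exI conjI)
  fix \<epsilon> :: real and D :: "real set set"
  assume \<epsilon>: "\<epsilon> > 0" and D: "D division_of \<Union>D" "measure lebesgue (\<Union>D) < \<epsilon>"
  have "(\<Sum>K\<in>D. norm (Sup K - Inf K)) = (\<Sum>K\<in>D. Sup K - Inf K)"
    using endpoints_in_division[OF D(1)] by (intro sum.cong) auto
  then show "(\<Sum>K\<in>D. norm (Sup K - Inf K)) < \<epsilon>" using division_measure(2)[OF D(1)] D(2) by simp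
qed

lemma abs_continuous_Lipschitz:
  assumes "\<And>x y. x \<in> {0..1} \<Longrightarrow> y \<in> {0..1} \<Longrightarrow> norm (F y - F x) \<le> c * \<bar>y - x\<bar>"
  shows "abs_continuous F"
proof (rule abs_continuous_combine[OF abs_continuous_ident abs_continuous_ident, of "\<bar>c\<bar> + 1"])
  fix x y :: real assume "x \<in> {0..1}" "y \<in> {0..1}"
  then have "norm (F y - F x) \<le> c * \<bar>y - x\<bar>" by (rule assms)
  also have "\<dots> \<le> (\<bar>c\<bar> + 1) * \<bar>y - x\<bar>" by (intro mult_right_mono) auto
  also have "\<dots> \<le> (\<bar>c\<bar> + 1) * \<bar>y - x\<bar> + (\<bar>c\<bar> + 1) * \<bar>y - x\<bar>" by simp
  finally show "norm (F y - F x) \<le> (\<bar>c\<bar> + 1) * norm (y - x) + (\<bar>c\<bar> + 1) * norm (y - x)" by simp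
qed auto

lemma abs_continuous_imp_continuous_on:
  assumes F: "abs_continuous F"
  shows "continuous_on {0..1} F"
  unfolding continuous_on_iff
proof (intro ballI allI impI)
  fix x \<epsilon> :: real assume x: "x \<in> {0..1}" and "\<epsilon> > 0"
  then obtain \<delta> where \<delta>: "\<delta> > 0" "\<And>D. D division_of \<Union>D \<Longrightarrow> \<Union>D \<subseteq> {0..1} \<Longrightarrow> measure lebesgue (\<Union>D) < \<delta> \<Longrightarrow>
        (\<Sum>K\<in>D. norm (F (Sup K) - F (Inf K))) < \<epsilon>"
    using abs_continuousE[OF F] by blast
  have "norm (F v - F u) < \<epsilon>" if "u \<in> {0..1}" "v \<in> {0..1}" "u \<le> v" "v - u < \<delta>" for u v
  proof -
    have "{{u..v}} division_of \<Union>{{u..v}}"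
      using that division_of_self[of u v] by simp
    then have "(\<Sum>K\<in>{{u..v}}. norm (F (Sup K) - F (Inf K))) < \<epsilon>"
      using that by (intro \<delta>) auto
    then show ?thesis using that by simp
  qed
  from this[of x] this[of _ x] x show "\<exists>d>0. \<forall>y\<in>{0..1}. dist y x < d \<longrightarrow> dist (F y) (F x) < \<epsilon>"
    using \<delta>(1) by (intro exI[of _ \<delta>]) (force simp: dist_norm dist_real_def norm_minus_commute abs_less_iff)
qed

lemma abs_continuous_bounded:
  assumes "abs_continuous F"
  obtains M where "M > 0" "\<And>x. x \<in> {0..1} \<Longrightarrow> norm (F x) \<le> M"
proof -
  have "bounded (F ` {0..1})"
    using abs_continuous_imp_continuous_on[OF assms] compact_continuous_image compact_imp_bounded by blast
  then show ?thesis using that by (auto simp: bounded_pos)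
qed

lemma abs_continuous_mult:
  fixes F G :: "real \<Rightarrow> 'a::real_normed_algebra"
  assumes F: "abs_continuous F" and G: "abs_continuous G"
  shows "abs_continuous (\<lambda>x. F x * G x)"
proof -
  obtain M where M: "M > 0" "\<And>x. x \<in> {0..1} \<Longrightarrow> norm (F x) \<le> M"
    using abs_continuous_bounded[OF F] by blast
  obtain M' where M': "M' > 0" "\<And>x. x \<in> {0..1} \<Longrightarrow> norm (G x) \<le> M'"
    using abs_continuous_bounded[OF G] by blast
  show ?thesis
  proof (rule abs_continuous_combine[OF F G, of "M + M'"])
    fix x y :: real assume xy: "x \<in> {0..1}" "y \<in> {0..1}"
    have "F y * G y - F x * G x = (F y - F x) * G y + F x * (G y - G x)" by (simp add: algebra_simps)
    also have "norm \<dots> \<le> norm (F y - F x) * norm (G y) + norm (F x) * norm (G y - G x)"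
      by (intro norm_triangle_le add_mono norm_mult_ineq)
    also have "\<dots> \<le> norm (F y - F x) * (M + M') + (M + M') * norm (G y - G x)"
      using M(1) M'(1) M(2)[OF xy(1)] M'(2)[OF xy(2)] by (intro add_mono mult_left_mono mult_right_mono) auto
    finally show "norm (F y * G y - F x * G x) \<le> (M + M') * norm (F y - F x) + (M + M') * norm (G y - G x)"
      by (simp add: mult.commute)
  qed (use M M' in auto)
qed

lemma abs_continuous_add:
  assumes F: "abs_continuous F" and G: "abs_continuous G"
  shows "abs_continuous (\<lambda>x. F x + G x)"
proof (rule abs_continuous_combine[OF F G, of 1])
  fix x y :: real
  show "norm (F y + G y - (F x + G x)) \<le> 1 * norm (F y - F x) + 1 * norm (G y - G x)"
    using norm_triangle_ineq[of "F y - F x" "G y - G x"] by (simp add: algebra_simps)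
qed auto

lemma abs_continuous_C1:
  fixes F :: "real \<Rightarrow> 'a::real_normed_vector"
  assumes d: "\<And>x. x \<in> {0..1} \<Longrightarrow> (F has_vector_derivative f x) (at x within {0..1})"
    and f: "continuous_on {0..1} f"
  shows "abs_continuous F"
proof -
  have "bounded (f ` {0..1})"
    using f compact_continuous_image compact_imp_bounded by blast
  then obtain M where M: "\<And>x. x \<in> {0..1} \<Longrightarrow> norm (f x) \<le> M"
    unfolding bounded_iff by blast
  show ?thesis
  proof (rule abs_continuous_Lipschitz)
    fix x y :: real assume xy: "x \<in> {0..1}" "y \<in> {0..1}"
    have "norm (F y - F x) \<le> M * norm (y - x)"
    proof (rule differentiable_bound[where S = "{0..1}" and f' = "\<lambda>x h. h *\<^sub>R f x"])
      fix z :: real assume z: "z \<in> {0..1}"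
      show "(F has_derivative (\<lambda>h. h *\<^sub>R f z)) (at z within {0..1})"
        using d[OF z] by (simp add: has_vector_derivative_def)
      show "onorm (\<lambda>h. h *\<^sub>R f z) \<le> M"
        using M[OF z] by (intro onorm_le) (simp add: mult.commute[of M] mult_left_mono)
    qed (use xy in auto)
    then show "norm (F y - F x) \<le> M * \<bar>y - x\<bar>" by simp
  qed
qed

lemma abs_continuous_differentiable_ae:
  fixes F :: "real \<Rightarrow> complex"
  assumes F: "abs_continuous F"
  obtains N where "negligible N" "\<And>x. x \<in> {0..1} - N \<Longrightarrow> F differentiable (at x)"
proof -
  have "abs_continuous (\<lambda>x. Re (F x))"
    by (rule abs_continuous_mono[OF F]) (metis abs_Re_le_cmod minus_complex.sel(1) real_norm_def)
  then obtain N1 where N1: "negligible N1" "\<And>x. x \<in> {0..1} - N1 \<Longrightarrow> (\<lambda>x. Re (F x)) differentiable (at x)"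
    using abs_continuous_differentiable_ae_real by blast
  have "abs_continuous (\<lambda>x. Im (F x))"
    by (rule abs_continuous_mono[OF F]) (metis abs_Im_le_cmod minus_complex.sel(2) real_norm_def)
  then obtain N2 where N2: "negligible N2" "\<And>x. x \<in> {0..1} - N2 \<Longrightarrow> (\<lambda>x. Im (F x)) differentiable (at x)"
    using abs_continuous_differentiable_ae_real by blast
  show ?thesis
  proof (rule that[of "N1 \<union> N2"])
    fix x :: real assume x: "x \<in> {0..1} - (N1 \<union> N2)"
    obtain r where r: "((\<lambda>x. Re (F x)) has_real_derivative r) (at x)"
      using N1(2)[of x] x by (auto simp: real_differentiable_def)
    obtain i where i: "((\<lambda>x. Im (F x)) has_real_derivative i) (at x)"
      using N2(2)[of x] x by (auto simp: real_differentiable_def)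
    have "(F has_vector_derivative Complex r i) (at x)"
      using r i by (simp add: has_vector_derivative_complex_iff has_real_derivative_iff_has_vector_derivative)
    then show "F differentiable (at x)"
      using differentiableI_vector by blast
  qed (use N1 N2 in \<open>simp add: negligible_Un\<close>)
qed

text \<open>
  The gauge separates two kinds of tags. At a tag outside \<open>N\<close> the derivative controls the
  increment over the interval up to \<open>c\<close> times its length. Intervals tagged in \<open>N\<close> are confined
  to an open set of small measure around \<open>N\<close>, where absolute continuity makes the total
  increment small while the integrand may be taken to be zero.
\<close>

lemma abs_continuous_FTC:
  fixes F :: "real \<Rightarrow> 'a::banach"
  assumes F: "abs_continuous F" and N: "negligible N"
    and der: "\<And>x. x \<in> {0..1} - N \<Longrightarrow> (F has_vector_derivative f x) (at x within {0..1})"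
    and ab: "0 \<le> a" "a \<le> b" "b \<le> 1"
  shows "(f has_integral F b - F a) {a..b}"
proof -
  define g where "g x = (if x \<in> N then 0 else f x)" for x
  have "(g has_integral F b - F a) {a..b}"
    unfolding has_integral_real
  proof (intro allI impI)
    fix e :: real assume e: "e > 0"
    obtain \<delta> where \<delta>: "\<delta> > 0" "\<And>D. D division_of \<Union>D \<Longrightarrow> \<Union>D \<subseteq> {0..1} \<Longrightarrow> measure lebesgue (\<Union>D) < \<delta> \<Longrightarrow>
        (\<Sum>K\<in>D. norm (F (Sup K) - F (Inf K))) < e / 2"
      using abs_continuousE[OF F half_gt_zero[OF e]] by blast
    have N_lm: "N \<in> lmeasurable" "measure lebesgue N = 0"
      using N by (auto simp: negligible_imp_measurable negligible_imp_measure0)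
    obtain W where W: "open W" "N \<subseteq> W" "W - N \<in> lmeasurable" "emeasure lebesgue (W - N) < ennreal \<delta>"
      using sets_lebesgue_outer_open[OF fmeasurableD[OF N_lm(1)] \<delta>(1)] by blast
    have W_lm: "W \<in> lmeasurable"
      using W(2,3) N_lm by (metis Diff_partition fmeasurable.Un)
    have "measure lebesgue (N \<union> (W - N)) \<le> measure lebesgue N + measure lebesgue (W - N)"
      using N_lm W by (intro measure_Un_le) auto
    moreover have "measure lebesgue (W - N) < \<delta>"
      using W(3,4) by (metis emeasure_eq_measure2 ennreal_less_iff measure_nonneg)
    ultimately have W_m: "measure lebesgue W < \<delta>"
      using N_lm W(2) by (simp add: Un_absorb1)
    define c where "c = e / (2 * (b - a + 1))"
    have c: "c > 0" "c * (b - a) \<le> e / 2"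
      using e ab by (auto simp: c_def field_simps)
    have "\<exists>d>0. \<forall>y\<in>{0..1}. \<bar>y - x\<bar> < d \<longrightarrow> norm (F y - F x - (y - x) *\<^sub>R f x) \<le> c * \<bar>y - x\<bar>"
      if "x \<in> {0..1} - N" for x
      using der[OF that] c(1) unfolding has_vector_derivative_def has_derivative_within_alt by auto
    then obtain d where d: "\<And>x. x \<in> {0..1} - N \<Longrightarrow> d x > 0"
      "\<And>x y. x \<in> {0..1} - N \<Longrightarrow> y \<in> {0..1} \<Longrightarrow> \<bar>y - x\<bar> < d x \<Longrightarrow>
         norm (F y - F x - (y - x) *\<^sub>R f x) \<le> c * \<bar>y - x\<bar>"
      by metis
    define \<gamma> where "\<gamma> x = (if x \<in> N then W else if x \<in> {0..1} then ball x (d x) else UNIV - {0..1})" for x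
    have g: "gauge \<gamma>"
      unfolding gauge_def \<gamma>_def using W d(1) by (auto intro!: open_Diff)
    have small: "norm ((\<Sum>(x, K)\<in>p. measure lborel K *\<^sub>R g x) - (F b - F a)) < e"
      if p: "p tagged_division_of {a..b}" and fine: "\<gamma> fine p" for p
    proof -
      \<comment> \<open>The value at the empty set makes degenerate intervals contribute zero, as required for
        passing from tagged to untagged divisions.\<close>
      define dF where "dF K = (if K = {} then 0 else F (Sup K) - F (Inf K))" for K
      define p1 where "p1 = {(x, K) \<in> p. x \<in> N}"
      define p2 where "p2 = {(x, K) \<in> p. x \<notin> N}"
      have fin: "finite p" using p by auto
      have p12: "p = p1 \<union> p2" "p1 \<inter> p2 = {}" "finite p1" "finite p2"
        using fin by (auto simp: p1_def p2_def intro: finite_subset[OF _ fin])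
      have K: "\<exists>u v. K = {u..v} \<and> u \<le> v \<and> u \<le> x \<and> x \<le> v \<and> a \<le> u \<and> v \<le> b" if xK: "(x, K) \<in> p" for x K
      proof -
        obtain u v where "K = cbox u v" using tagged_division_ofD(4)[OF p xK] by blast
        moreover have "x \<in> K" "K \<subseteq> {a..b}" using tagged_division_ofD(2,3)[OF p xK] by auto
        ultimately show ?thesis by (intro exI[of _ u] exI[of _ v]) auto
      qed
      have "(\<Sum>(x, K)\<in>p. F (Sup K) - F (Inf K)) = F b - F a"
        using additive_tagged_division_1[OF ab(2) p] .
      also have "(\<Sum>(x, K)\<in>p. F (Sup K) - F (Inf K)) = (\<Sum>(x, K)\<in>p. dF K)"
        using K by (intro sum.cong) (fastforce simp: dF_def)+
      finally have "(\<Sum>(x, K)\<in>p. measure lborel K *\<^sub>R g x) - (F b - F a) = (\<Sum>(x, K)\<in>p. measure lborel K *\<^sub>R g x - dF K)"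
        by (simp add: sum_subtractf split_beta')
      also have "\<dots> = (\<Sum>(x, K)\<in>p1. measure lborel K *\<^sub>R g x - dF K) + (\<Sum>(x, K)\<in>p2. measure lborel K *\<^sub>R g x - dF K)"
        unfolding p12(1) by (rule sum.union_disjoint[OF p12(3,4,2)])
      finally have split: "(\<Sum>(x, K)\<in>p. measure lborel K *\<^sub>R g x) - (F b - F a) = \<dots>" .
      have n1: "norm (\<Sum>(x, K)\<in>p1. measure lborel K *\<^sub>R g x - dF K) < e / 2"
      proof -
        have "norm (\<Sum>(x, K)\<in>p1. measure lborel K *\<^sub>R g x - dF K) \<le> (\<Sum>(x, K)\<in>p1. norm (dF K))"
          by (rule sum_norm_le) (auto simp: p1_def g_def)
        also have p1_tag: "p1 tagged_division_of \<Union>(snd ` p1)"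
        proof (rule tagged_partial_division_of_Union_self)
          show "p1 tagged_partial_division_of {a..b}"
            using p p12(1) by (meson Un_upper1 tagged_division_of_def tagged_partial_division_subset)
        qed
        then have "(\<Sum>(x, K)\<in>p1. norm (dF K)) = (\<Sum>K\<in>snd ` p1. norm (dF K))"
          by (rule sum.over_tagged_division_lemma) (auto simp: dF_def)
        also have "\<dots> = (\<Sum>K\<in>snd ` p1. norm (F (Sup K) - F (Inf K)))"
          using K by (intro sum.cong) (fastforce simp: dF_def p1_def)+
        also have "\<dots> < e / 2"
        proof (rule \<delta>)
          show div: "snd ` p1 division_of \<Union>(snd ` p1)"
            using division_of_tagged_division[OF p1_tag] .
          show "\<Union>(snd ` p1) \<subseteq> {0..1}"
            using K ab unfolding p1_def by fastforce
          have "\<Union>(snd ` p1) \<subseteq> W"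
            using fine unfolding fine_def p1_def \<gamma>_def by fastforce
          then have "measure lebesgue (\<Union>(snd ` p1)) \<le> measure lebesgue W"
            using division_measure(1)[OF div] W_lm by (intro measure_mono_fmeasurable) auto
          then show "measure lebesgue (\<Union>(snd ` p1)) < \<delta>" using W_m by linarith
        qed
        finally show ?thesis .
      qed
      have n2: "norm (\<Sum>(x, K)\<in>p2. measure lborel K *\<^sub>R g x - dF K) \<le> e / 2"
      proof -
        have "norm (\<Sum>(x, K)\<in>p2. measure lborel K *\<^sub>R g x - dF K) \<le> (\<Sum>(x, K)\<in>p2. c * (Sup K - Inf K))"
        proof (rule sum_norm_le, clarify)
          fix x J assume xJ: "(x, J) \<in> p2"
          then have xp: "(x, J) \<in> p" and xN: "x \<notin> N" by (auto simp: p2_def)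
          obtain u v where uv: "J = {u..v}" "u \<le> v" "u \<le> x" "x \<le> v" "a \<le> u" "v \<le> b" using K[OF xp] by blast
          have x01: "x \<in> {0..1} - N" using uv ab xN by auto
          have sub: "J \<subseteq> ball x (d x)"
          proof -
            have "J \<subseteq> \<gamma> x" using fine xp by (auto simp: fine_def)
            then show ?thesis using x01 by (simp add: \<gamma>_def)
          qed
          have "u \<in> J" "v \<in> J" using uv by auto
          then have "u \<in> ball x (d x)" "v \<in> ball x (d x)" using sub by blast+
          then have uvd: "\<bar>u - x\<bar> < d x" "\<bar>v - x\<bar> < d x" by (auto simp: dist_real_def)
          have u: "norm (F u - F x - (u - x) *\<^sub>R f x) \<le> c * \<bar>u - x\<bar>"
            using uvd uv ab by (intro d(2)[OF x01]) auto
          have v: "norm (F v - F x - (v - x) *\<^sub>R f x) \<le> c * \<bar>v - x\<bar>"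
            using uvd uv ab by (intro d(2)[OF x01]) auto
          have "measure lborel J *\<^sub>R g x - dF J = (F u - F x - (u - x) *\<^sub>R f x) - (F v - F x - (v - x) *\<^sub>R f x)"
            using uv xN by (simp add: dF_def g_def algebra_simps)
          also have "norm \<dots> \<le> c * \<bar>u - x\<bar> + c * \<bar>v - x\<bar>"
            using u v norm_triangle_ineq4 by (meson add_mono order_trans)
          also have "\<dots> = c * (Sup J - Inf J)" using uv by (simp add: algebra_simps)
          finally show "norm (measure lborel J *\<^sub>R g x - dF J) \<le> c * (Sup J - Inf J)" .
        qed
        also have "\<dots> \<le> (\<Sum>(x, K)\<in>p. c * (Sup K - Inf K))"
        proof (rule sum_mono2[OF fin])
          show "p2 \<subseteq> p" using p12(1) by blast
          fix z assume "z \<in> p - p2"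
          moreover obtain x J where z: "z = (x, J)" by fastforce
          ultimately obtain u v where "J = {u..v}" "u \<le> v" using K[of x J] by blast
          then show "0 \<le> (case z of (x, K) \<Rightarrow> c * (Sup K - Inf K))" using c(1) z by simp
        qed
        also have "\<dots> = c * (\<Sum>(x, K)\<in>p. Sup K - Inf K)"
          by (simp add: sum_distrib_left split_beta')
        also have "\<dots> = c * (b - a)"
          using additive_tagged_division_1[OF ab(2) p, of "\<lambda>x. x"] by simp
        finally show ?thesis using c(2) by linarith
      qed
      show ?thesis
        unfolding split by (rule le_less_trans[OF norm_triangle_ineq]) (use n1 n2 in linarith)
    qed
    show "\<exists>\<gamma>. gauge \<gamma> \<and> (\<forall>p. p tagged_division_of {a..b} \<and> \<gamma> fine p \<longrightarrow>
        norm ((\<Sum>(x, K)\<in>p. measure lborel K *\<^sub>R g x) - (F b - F a)) < e)"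
      by (intro exI[of _ \<gamma>] conjI allI impI g) (elim conjE, rule small)
  qed
  from has_integral_spike[OF N _ this, of f] show ?thesis
    by (simp add: g_def)
qed

section \<open>Square integrable functions on the unit interval\<close>

abbreviation unit_measure :: "real measure" where
  "unit_measure \<equiv> lebesgue_on {0..1}"

lemma set_integrable_unit:
  fixes f :: "real \<Rightarrow> 'a::{banach, second_countable_topology}"
  shows "set_integrable lebesgue {0..1} f \<longleftrightarrow> integrable unit_measure f"
  by (simp add: set_integrable_def integrable_restrict_space)

lemma set_integral_unit:
  fixes f :: "real \<Rightarrow> 'a::{banach, second_countable_topology}"
  shows "(LINT x:{0..1}|lebesgue. f x) = integral\<^sup>L unit_measure f"
  by (simp add: set_lebesgue_integral_def integral_restrict_space)

lemma set_borel_measurable_unit: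
  fixes f :: "real \<Rightarrow> 'a::{banach, second_countable_topology}"
  shows "set_borel_measurable lebesgue {0..1} f \<longleftrightarrow> f \<in> borel_measurable unit_measure"
  by (simp add: set_borel_measurable_def borel_measurable_restrict_space_iff)

lemma measure_unit_UNIV [simp]: "measure unit_measure {0..1} = 1"
  by (simp add: measure_restrict_space)

lemma continuous_integrable_unit:
  fixes f :: "real \<Rightarrow> 'a::euclidean_space"
  shows "continuous_on {0..1} f \<Longrightarrow> integrable unit_measure f"
  using continuous_imp_integrable[of 0 1 f] by simp

lemma continuous_measurable_unit:
  fixes f :: "real \<Rightarrow> 'a::euclidean_space"
  shows "continuous_on {0..1} f \<Longrightarrow> f \<in> borel_measurable unit_measure"
  by (rule continuous_imp_measurable_on_sets_lebesgue) auto

definition square_integrable :: "(real \<Rightarrow> complex) \<Rightarrow> bool" where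
  "square_integrable f \<longleftrightarrow>
     f \<in> borel_measurable unit_measure \<and> integrable unit_measure (\<lambda>x. (norm (f x))\<^sup>2)"

definition L2_norm_sq :: "(real \<Rightarrow> complex) \<Rightarrow> real" where
  "L2_norm_sq f = (LINT x|unit_measure. (norm (f x))\<^sup>2)"

lemma L2_norm_sq_nonneg [simp]: "L2_norm_sq f \<ge> 0"
  by (simp add: L2_norm_sq_def)

lemma square_integrable_measurable:
  "square_integrable f \<Longrightarrow> f \<in> borel_measurable unit_measure"
  by (simp add: square_integrable_def)

lemma square_integrable_bounded_mult:
  assumes f: "square_integrable f" and g: "g \<in> borel_measurable unit_measure"
    and M: "\<And>x. x \<in> {0..1} \<Longrightarrow> norm (g x) \<le> M"
  shows "square_integrable (\<lambda>x. f x * g x)"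
  unfolding square_integrable_def
proof
  note [measurable] = square_integrable_measurable[OF f] g
  show "(\<lambda>x. f x * g x) \<in> borel_measurable unit_measure" by measurable
  show "integrable unit_measure (\<lambda>x. (norm (f x * g x))\<^sup>2)"
  proof (rule Bochner_Integration.integrable_bound)
    show "integrable unit_measure (\<lambda>x. M\<^sup>2 * (norm (f x))\<^sup>2)"
      using f by (simp add: square_integrable_def)
    show "AE x in unit_measure. norm ((norm (f x * g x))\<^sup>2) \<le> norm (M\<^sup>2 * (norm (f x))\<^sup>2)"
    proof (rule AE_I2)
      fix x assume "x \<in> space unit_measure"
      then have "norm (g x) \<le> M" using M by simp
      then have "norm (f x) * norm (g x) \<le> norm (f x) * M" by (rule mult_left_mono) simp
      then have "(norm (f x) * norm (g x))\<^sup>2 \<le> (norm (f x) * M)\<^sup>2" by (rule power_mono) simp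
      then show "norm ((norm (f x * g x))\<^sup>2) \<le> norm (M\<^sup>2 * (norm (f x))\<^sup>2)"
        by (simp add: norm_mult power_mult_distrib mult.commute)
    qed
  qed measurable
qed

lemma square_integrable_const [simp]: "square_integrable (\<lambda>x. c)"
  by (simp add: square_integrable_def continuous_integrable_unit)

lemma square_integrable_continuous:
  assumes "continuous_on {0..1} f"
  shows "square_integrable f"
  unfolding square_integrable_def
  by (intro conjI continuous_measurable_unit continuous_integrable_unit continuous_intros assms)

lemma square_integrable_continuous_mult:
  assumes f: "square_integrable f" and g: "continuous_on {0..1} g"
  shows "square_integrable (\<lambda>x. f x * g x)"
proof -
  have "bounded (g ` {0..1})"
    using g compact_continuous_image compact_imp_bounded by blast
  then obtain M where "\<And>x. x \<in> {0..1} \<Longrightarrow> norm (g x) \<le> M"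
    unfolding bounded_iff by blast
  then show ?thesis
    using square_integrable_bounded_mult[OF f continuous_measurable_unit[OF g]] by blast
qed

lemma square_integrable_add:
  assumes f: "square_integrable f" and g: "square_integrable g"
  shows "square_integrable (\<lambda>x. f x + g x)"
  unfolding square_integrable_def
proof
  note [measurable] = square_integrable_measurable[OF f] square_integrable_measurable[OF g]
  show "(\<lambda>x. f x + g x) \<in> borel_measurable unit_measure" by measurable
  show "integrable unit_measure (\<lambda>x. (norm (f x + g x))\<^sup>2)"
  proof (rule Bochner_Integration.integrable_bound)
    show "integrable unit_measure (\<lambda>x. 2 * (norm (f x))\<^sup>2 + 2 * (norm (g x))\<^sup>2)"
      using f g by (simp add: square_integrable_def)
    show "AE x in unit_measure. norm ((norm (f x + g x))\<^sup>2) \<le> norm (2 * (norm (f x))\<^sup>2 + 2 * (norm (g x))\<^sup>2)"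
    proof (rule AE_I2)
      fix x
      have "(norm (f x + g x))\<^sup>2 \<le> (norm (f x) + norm (g x))\<^sup>2"
        by (intro power_mono norm_triangle_ineq) simp
      also have "\<dots> \<le> 2 * (norm (f x))\<^sup>2 + 2 * (norm (g x))\<^sup>2"
        using zero_le_power2[of "norm (f x) - norm (g x)"] by (simp add: power2_sum power2_diff)
      finally show "norm ((norm (f x + g x))\<^sup>2) \<le> norm (2 * (norm (f x))\<^sup>2 + 2 * (norm (g x))\<^sup>2)"
        by simp
    qed
  qed measurable
qed

lemma square_integrable_diff:
  assumes f: "square_integrable f" and g: "square_integrable g"
  shows "square_integrable (\<lambda>x. f x - g x)"
  using square_integrable_add[OF f square_integrable_continuous_mult[OF g, of "\<lambda>_. -1"]] by simp

lemma square_integrable_product_norm: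
  assumes f: "square_integrable f" and g: "square_integrable g"
  shows "integrable unit_measure (\<lambda>x. norm (f x) * norm (g x))"
proof (rule Bochner_Integration.integrable_bound)
  show "integrable unit_measure (\<lambda>x. (norm (f x))\<^sup>2 + (norm (g x))\<^sup>2)"
    using f g by (simp add: square_integrable_def)
  show "AE x in unit_measure. norm (norm (f x) * norm (g x)) \<le> norm ((norm (f x))\<^sup>2 + (norm (g x))\<^sup>2)"
  proof (rule AE_I2)
    fix x
    have "2 * (norm (f x) * norm (g x)) \<le> (norm (f x))\<^sup>2 + (norm (g x))\<^sup>2"
      using zero_le_power2[of "norm (f x) - norm (g x)"] by (simp add: power2_diff)
    moreover have "0 \<le> norm (f x) * norm (g x)" by simp
    ultimately show "norm (norm (f x) * norm (g x)) \<le> norm ((norm (f x))\<^sup>2 + (norm (g x))\<^sup>2)"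
      unfolding real_norm_def by linarith
  qed
  note [measurable] = square_integrable_measurable[OF f] square_integrable_measurable[OF g]
  show "(\<lambda>x. norm (f x) * norm (g x)) \<in> borel_measurable unit_measure" by measurable
qed

lemma square_integrable_product:
  assumes f: "square_integrable f" and g: "square_integrable g"
  shows "integrable unit_measure (\<lambda>x. f x * g x)"
proof (rule Bochner_Integration.integrable_bound[OF square_integrable_product_norm[OF f g]])
  note [measurable] = square_integrable_measurable[OF f] square_integrable_measurable[OF g]
  show "(\<lambda>x. f x * g x) \<in> borel_measurable unit_measure" by measurable
qed (simp add: norm_mult)

lemma square_integrable_integrable: "square_integrable f \<Longrightarrow> integrable unit_measure f"
  using square_integrable_product[of f "\<lambda>_. 1"] by simp

lemma Cauchy_Schwarz_L2:
  assumes f: "square_integrable f" and g: "square_integrable g"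
  shows "(LINT x|unit_measure. norm (f x) * norm (g x)) \<le> sqrt (L2_norm_sq f) * sqrt (L2_norm_sq g)"
proof -
  note [measurable] = square_integrable_measurable[OF f] square_integrable_measurable[OF g]
  define I where "I = (LINT x|unit_measure. norm (f x) * norm (g x))"
  have I: "I \<ge> 0" by (simp add: I_def)
  have "(ennreal I)\<^sup>2 = (\<integral>\<^sup>+x. ennreal (norm (f x)) * ennreal (norm (g x)) \<partial>unit_measure)\<^sup>2"
    unfolding I_def using square_integrable_product_norm[OF f g]
    by (subst nn_integral_eq_integral[symmetric]) (simp_all add: ennreal_mult)
  also have "\<dots> \<le> (\<integral>\<^sup>+x. (ennreal (norm (f x)))\<^sup>2 \<partial>unit_measure) * (\<integral>\<^sup>+x. (ennreal (norm (g x)))\<^sup>2 \<partial>unit_measure)"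
    by (rule Cauchy_Schwarz_nn_integral) measurable
  also have "(\<integral>\<^sup>+x. (ennreal (norm (f x)))\<^sup>2 \<partial>unit_measure) = ennreal (L2_norm_sq f)"
    unfolding L2_norm_sq_def using f
    by (subst nn_integral_eq_integral[symmetric]) (simp_all add: square_integrable_def ennreal_power)
  also have "(\<integral>\<^sup>+x. (ennreal (norm (g x)))\<^sup>2 \<partial>unit_measure) = ennreal (L2_norm_sq g)"
    unfolding L2_norm_sq_def using g
    by (subst nn_integral_eq_integral[symmetric]) (simp_all add: square_integrable_def ennreal_power)
  finally have "I\<^sup>2 \<le> L2_norm_sq f * L2_norm_sq g"
    using I by (simp add: ennreal_power ennreal_mult[symmetric])
  then have "sqrt (I\<^sup>2) \<le> sqrt (L2_norm_sq f * L2_norm_sq g)" by (rule real_sqrt_le_mono)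
  then show ?thesis using I by (simp add: real_sqrt_mult I_def)
qed

lemma norm_integral_product_le:
  assumes f: "square_integrable f" and g: "square_integrable g"
  shows "norm (LINT x|unit_measure. f x * g x) \<le> sqrt (L2_norm_sq f) * sqrt (L2_norm_sq g)"
proof -
  have "norm (LINT x|unit_measure. f x * g x) \<le> (LINT x|unit_measure. norm (f x * g x))"
    by (rule integral_norm_bound)
  then show ?thesis using Cauchy_Schwarz_L2[OF f g] by (simp add: norm_mult)
qed

section \<open>Square integrable derivatives\<close>

text \<open>
  Membership in the Sobolev space of order one together with its derivative, the form in which
  the hypothesis \<open>f \<in> Hs s\<close> is used at every level \<open>hderiv l f\<close> with \<open>l < s\<close>. The derivative is
  kept as a separate argument because it is determined only almost everywhere.
\<close>

definition has_L2_derivative :: "(real \<Rightarrow> complex) \<Rightarrow> (real \<Rightarrow> complex) \<Rightarrow> bool" where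
  "has_L2_derivative F f \<longleftrightarrow> abs_continuous F \<and> square_integrable f \<and>
     (\<exists>N. negligible N \<and> (\<forall>x \<in> {0..1} - N. (F has_vector_derivative f x) (at x within {0..1})))"

lemma has_L2_derivative_C1:
  assumes "\<And>x. x \<in> {0..1} \<Longrightarrow> (F has_vector_derivative f x) (at x within {0..1})"
    and "continuous_on {0..1} f"
  shows "has_L2_derivative F f"
  using assms abs_continuous_C1[OF assms] square_integrable_continuous[of f]
  unfolding has_L2_derivative_def by (auto intro!: exI[of _ "{}"])

lemma has_L2_derivative_continuous:
  "has_L2_derivative F f \<Longrightarrow> continuous_on {0..1} F"
  by (simp add: has_L2_derivative_def abs_continuous_imp_continuous_on)

lemma has_L2_derivative_add:
  assumes "has_L2_derivative F f" "has_L2_derivative G g"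
  shows "has_L2_derivative (\<lambda>x. F x + G x) (\<lambda>x. f x + g x)"
proof -
  obtain N where N: "negligible N" "\<And>x. x \<in> {0..1} - N \<Longrightarrow> (F has_vector_derivative f x) (at x within {0..1})"
    using assms unfolding has_L2_derivative_def by blast
  obtain N' where N': "negligible N'" "\<And>x. x \<in> {0..1} - N' \<Longrightarrow> (G has_vector_derivative g x) (at x within {0..1})"
    using assms unfolding has_L2_derivative_def by blast
  have "((\<lambda>x. F x + G x) has_vector_derivative f x + g x) (at x within {0..1})" if "x \<in> {0..1} - (N \<union> N')" for x
    using that by (intro has_vector_derivative_add N N') auto
  then show ?thesis
    using assms N(1) N'(1) unfolding has_L2_derivative_def
    by (intro conjI exI[of _ "N \<union> N'"]) (auto intro: abs_continuous_add square_integrable_add)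
qed

text \<open>
  Integration by parts is the fundamental theorem applied to this product.
\<close>

lemma has_L2_derivative_mult:
  assumes F: "has_L2_derivative F f" and G: "has_L2_derivative G g" and g: "continuous_on {0..1} g"
  shows "has_L2_derivative (\<lambda>x. F x * G x) (\<lambda>x. F x * g x + f x * G x)"
proof -
  obtain N where N: "negligible N" "\<And>x. x \<in> {0..1} - N \<Longrightarrow> (F has_vector_derivative f x) (at x within {0..1})"
    using F unfolding has_L2_derivative_def by blast
  obtain N' where N': "negligible N'" "\<And>x. x \<in> {0..1} - N' \<Longrightarrow> (G has_vector_derivative g x) (at x within {0..1})"
    using G unfolding has_L2_derivative_def by blast
  have "((\<lambda>x. F x * G x) has_vector_derivative F x * g x + f x * G x) (at x within {0..1})"
    if "x \<in> {0..1} - (N \<union> N')" for x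
    using that by (intro has_vector_derivative_mult N N') auto
  moreover have "square_integrable (\<lambda>x. F x * g x + f x * G x)"
  proof (rule square_integrable_add)
    show "square_integrable (\<lambda>x. F x * g x)"
      using has_L2_derivative_continuous[OF F] g by (intro square_integrable_continuous continuous_intros)
    show "square_integrable (\<lambda>x. f x * G x)"
      using F has_L2_derivative_continuous[OF G]
      by (intro square_integrable_continuous_mult) (auto simp: has_L2_derivative_def)
  qed
  ultimately show ?thesis
    using F G N(1) N'(1) unfolding has_L2_derivative_def
    by (intro conjI exI[of _ "N \<union> N'"]) (auto intro: abs_continuous_mult)
qed

lemma has_L2_derivative_FTC:
  assumes "has_L2_derivative F f" "0 \<le> a" "a \<le> b" "b \<le> 1"
  shows "(f has_integral F b - F a) {a..b}"
  using assms unfolding has_L2_derivative_def by (blast intro: abs_continuous_FTC)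

lemma integral_L2_derivative:
  assumes F: "has_L2_derivative F f"
  shows "(LINT x|unit_measure. f x) = F 1 - F 0"
proof -
  have "integrable unit_measure f"
    using F square_integrable_integrable by (auto simp: has_L2_derivative_def)
  then have "(f has_integral (LINT x|unit_measure. f x)) {0..1}"
    by (rule has_integral_integral_lebesgue_on) auto
  moreover have "(f has_integral F 1 - F 0) {0..1}"
    using has_L2_derivative_FTC[OF F] by simp
  ultimately show ?thesis by (rule has_integral_unique)
qed

lemma integral_by_parts_L2:
  assumes F: "has_L2_derivative F f" and G: "has_L2_derivative G g" and g: "continuous_on {0..1} g"
  shows "(LINT x|unit_measure. f x * G x) = F 1 * G 1 - F 0 * G 0 - (LINT x|unit_measure. F x * g x)"
proof -
  have "integrable unit_measure (\<lambda>x. F x * g x)"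
    using has_L2_derivative_continuous[OF F] g by (intro continuous_integrable_unit continuous_intros)
  moreover have "integrable unit_measure (\<lambda>x. f x * G x)"
    using F G by (intro square_integrable_product square_integrable_continuous[OF has_L2_derivative_continuous[OF G]])
       (auto simp: has_L2_derivative_def)
  ultimately show ?thesis
    using integral_L2_derivative[OF has_L2_derivative_mult[OF F G g]] by (simp add: algebra_simps)
qed

lemma L2_derivative_increment_le:
  assumes F: "has_L2_derivative F f" and xy: "x \<in> {0..1}" "y \<in> {0..1}"
  shows "norm (F x - F y) \<le> sqrt (L2_norm_sq f)"
proof -
  have f: "square_integrable f" using F by (simp add: has_L2_derivative_def)
  have "norm (F b - F a) \<le> sqrt (L2_norm_sq f)" if ab: "0 \<le> a" "a \<le> b" "b \<le> 1" for a b
  proof -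
    have fi: "(f has_integral F b - F a) {a..b}" by (rule has_L2_derivative_FTC[OF F ab])
    have "integrable unit_measure (\<lambda>x. norm (f x))"
      using square_integrable_integrable[OF f] by simp
    then have ni: "((\<lambda>x. norm (f x)) has_integral (LINT x|unit_measure. norm (f x))) {0..1}"
      by (rule has_integral_integral_lebesgue_on) auto
    have ni': "(\<lambda>x. norm (f x)) integrable_on {a..b}"
      by (rule integrable_on_subinterval[OF has_integral_integrable[OF ni]]) (use ab in simp)
    have "norm (integral {a..b} f) \<le> integral {a..b} (\<lambda>x. norm (f x))"
      by (rule integral_norm_bound_integral[OF has_integral_integrable[OF fi] ni']) simp
    also have "\<dots> \<le> integral {0..1} (\<lambda>x. norm (f x))"
      by (rule integral_subset_le[OF _ ni' has_integral_integrable[OF ni]]) (use ab in auto)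
    also have "\<dots> = (LINT x|unit_measure. norm (f x) * norm (1::complex))"
      using ni by (simp add: integral_unique)
    also have "\<dots> \<le> sqrt (L2_norm_sq f) * sqrt (L2_norm_sq (\<lambda>_. 1))"
      by (rule Cauchy_Schwarz_L2[OF f]) simp
    finally show ?thesis using fi by (simp add: integral_unique L2_norm_sq_def)
  qed
  from this[of x y] this[of y x] xy show ?thesis
    by (cases "x \<le> y") (auto simp: norm_minus_commute)
qed

section \<open>Fourier coefficients and Bessel's identity\<close>

definition osc :: "int \<Rightarrow> real \<Rightarrow> complex" where
  "osc k x = exp (- (2 * of_real pi * \<i> * of_int k * of_real x))"

lemma osc_integral_eq: "osc_integral k f = (LINT x|unit_measure. f x * osc k x)"
  by (simp add: osc_integral_def osc_def set_integral_unit)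

lemma osc_0 [simp]: "osc k 0 = 1" "osc 0 x = 1"
  by (simp_all add: osc_def)

lemma osc_1 [simp]: "osc k 1 = 1"
proof -
  have "osc k 1 = exp (2 * of_int (-k) * of_real pi * \<i>)"
    by (simp add: osc_def mult_ac)
  also have "\<dots> = 1" using exp_integer_2pi[of "of_int (-k)"] by simp
  finally show ?thesis .
qed

lemma osc_add: "osc (j + k) x = osc j x * osc k x"
  by (simp add: osc_def exp_add[symmetric] algebra_simps)

lemma norm_osc [simp]: "norm (osc k x) = 1"
  by (simp add: osc_def)

lemma osc_minus_mult [simp]: "osc (- k) x * osc k x = 1"
  using osc_add[of "-k" k x] by simp

lemma osc_has_derivative:
  "(osc k has_vector_derivative (- (2 * of_real pi * \<i> * of_int k) * osc k x)) (at x within S)"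
proof -
  have "((\<lambda>z. exp (- (2 * of_real pi * \<i> * of_int k) * z)) has_field_derivative
      (- (2 * of_real pi * \<i> * of_int k) * exp (- (2 * of_real pi * \<i> * of_int k) * of_real x))) (at (of_real x))"
    by (auto intro!: derivative_eq_intros)
  from has_vector_derivative_real_field[OF this]
  show ?thesis
    by (simp add: osc_def[abs_def] has_vector_derivative_at_within mult_ac)
qed

lemma continuous_on_osc [continuous_intros]: "continuous_on S (osc k)"
  unfolding osc_def[abs_def] by (intro continuous_intros)

lemma osc_has_L2_derivative: "has_L2_derivative (osc k) (\<lambda>x. - (2 * of_real pi * \<i> * of_int k) * osc k x)"
  by (intro has_L2_derivative_C1 osc_has_derivative continuous_intros)

lemma integral_osc: "(LINT x|unit_measure. osc k x) = (if k = 0 then 1 else 0)"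
proof (cases "k = 0")
  case False
  have "(LINT x|unit_measure. - (2 * of_real pi * \<i> * of_int k) * osc k x) = 0"
    using integral_L2_derivative[OF osc_has_L2_derivative[of k]] by simp
  then show ?thesis using False by simp
qed simp

text \<open>
  Since the mode \<open>osc k\<close> takes the value \<open>1\<close> at both endpoints, the boundary term of the
  integration by parts is the jump \<open>F 1 - F 0\<close>.
\<close>

lemma osc_integral_derivative:
  assumes F: "has_L2_derivative F f"
  shows "osc_integral k f = F 1 - F 0 + (2 * of_real pi * \<i> * of_int k) * osc_integral k F"
proof -
  have "osc_integral k f = F 1 * osc k 1 - F 0 * osc k 0 - (LINT x|unit_measure. F x * (- (2 * of_real pi * \<i> * of_int k) * osc k x))"
    unfolding osc_integral_eq
    by (intro integral_by_parts_L2[OF F osc_has_L2_derivative] continuous_intros)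
  also have "(LINT x|unit_measure. F x * (- (2 * of_real pi * \<i> * of_int k) * osc k x)) =
     (LINT x|unit_measure. - (2 * of_real pi * \<i> * of_int k) * (F x * osc k x))"
    by (simp only: mult_ac)
  also have "\<dots> = - (2 * of_real pi * \<i> * of_int k) * osc_integral k F"
    unfolding osc_integral_eq by (rule integral_mult_right_zero)
  finally show ?thesis by simp
qed

lemma osc_integral_diff:
  assumes "square_integrable f" "square_integrable g"
  shows "osc_integral k (\<lambda>x. f x - g x) = osc_integral k f - osc_integral k g"
proof -
  have "integrable unit_measure (\<lambda>x. h x * osc k x)" if "square_integrable h" for h
    by (rule square_integrable_product[OF that square_integrable_continuous[OF continuous_on_osc]])
  then show ?thesis
    unfolding osc_integral_eq using assms by (simp add: left_diff_distrib)
qed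

text \<open>
  Pythagoras: removing the component along one mode of norm one lowers the squared norm by the
  squared modulus of the coefficient.
\<close>

lemma L2_norm_sq_minus_mode:
  assumes g: "square_integrable g"
  shows "L2_norm_sq (\<lambda>x. g x - osc_integral k g * osc (-k) x) = L2_norm_sq g - (norm (osc_integral k g))\<^sup>2"
proof -
  define c where "c = osc_integral k g"
  have gk: "integrable unit_measure (\<lambda>x. g x * osc k x)"
    by (rule square_integrable_product[OF g square_integrable_continuous[OF continuous_on_osc]])
  have "(norm (g x - c * osc (-k) x))\<^sup>2 = (norm (g x))\<^sup>2 - 2 * Re (cnj c * (g x * osc k x)) + (norm c)\<^sup>2" for x
  proof -
    \<comment> \<open>Multiplication by \<open>osc k\<close>, of modulus one, turns the mode into a constant.\<close>
    have "(norm (g x - c * osc (-k) x))\<^sup>2 = (norm ((g x - c * osc (-k) x) * osc k x))\<^sup>2"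
      by (simp add: norm_mult)
    also have "(g x - c * osc (-k) x) * osc k x = g x * osc k x - c"
      by (simp add: left_diff_distrib mult.assoc)
    also have "(norm (g x * osc k x - c))\<^sup>2 = (norm (g x * osc k x))\<^sup>2 - 2 * Re (cnj c * (g x * osc k x)) + (norm c)\<^sup>2"
      unfolding cmod_power2 by (simp add: power2_eq_square algebra_simps)
    finally show ?thesis by (simp add: norm_mult)
  qed
  moreover define r where "r x = Re (cnj c * (g x * osc k x))" for x
  ultimately have "L2_norm_sq (\<lambda>x. g x - c * osc (-k) x) =
     (LINT x|unit_measure. (norm (g x))\<^sup>2 - 2 * r x + (norm c)\<^sup>2)"
    by (simp add: L2_norm_sq_def)
  also have "\<dots> = L2_norm_sq g - 2 * (LINT x|unit_measure. r x) + (norm c)\<^sup>2"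
  proof -
    have "integrable unit_measure r"
      unfolding r_def using gk by (intro integrable_Re integrable_mult_right) auto
    then show ?thesis
      using g by (simp add: L2_norm_sq_def square_integrable_def)
  qed
  also have "(LINT x|unit_measure. r x) = Re (cnj c * c)"
    unfolding r_def using gk by (subst integral_Re) (simp_all add: c_def osc_integral_eq)
  also have "Re (cnj c * c) = (norm c)\<^sup>2"
    unfolding cmod_power2 by (simp add: power2_eq_square)
  finally show ?thesis by (simp add: c_def)
qed

text \<open>
  Removing the mean splits off the squared modulus of the mean, and the remainder is bounded
  pointwise by the largest increment of \<open>F\<close>, hence by the norm of \<open>f\<close>. Since the constant is
  \<open>1\<close>, the inequality can be iterated without leaving the unit ball of \<open>Hs s\<close>.
\<close>

lemma Poincare_inequality:
  assumes F: "has_L2_derivative F f"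
  shows "L2_norm_sq F \<le> (norm (LINT x|unit_measure. F x))\<^sup>2 + L2_norm_sq f"
proof -
  define c where "c = (LINT x|unit_measure. F x)"
  have cont: "continuous_on {0..1} F" by (rule has_L2_derivative_continuous[OF F])
  have c: "osc_integral 0 F = c" by (simp add: osc_integral_eq c_def)
  have le: "norm (F x - c) \<le> sqrt (L2_norm_sq f)" if x: "x \<in> {0..1}" for x
  proof -
    have "F x - c = (LINT y|unit_measure. F x - F y)"
      using continuous_integrable_unit[OF cont] by (simp add: c_def)
    also have "norm \<dots> \<le> (LINT y|unit_measure. norm (F x - F y))" by (rule integral_norm_bound)
    also have "\<dots> \<le> (LINT y|unit_measure. sqrt (L2_norm_sq f))"
      using cont L2_derivative_increment_le[OF F x]
      by (intro integral_mono continuous_integrable_unit continuous_intros) auto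
    finally show ?thesis by simp
  qed
  have "L2_norm_sq (\<lambda>x. F x - c) \<le> (LINT x|unit_measure. L2_norm_sq f)"
    unfolding L2_norm_sq_def[of "\<lambda>x. F x - c"]
  proof (intro integral_mono continuous_integrable_unit continuous_intros cont)
    fix x assume "x \<in> space unit_measure"
    then have "(norm (F x - c))\<^sup>2 \<le> (sqrt (L2_norm_sq f))\<^sup>2" using le by (intro power_mono) auto
    then show "(norm (F x - c))\<^sup>2 \<le> L2_norm_sq f" by simp
  qed
  moreover have "L2_norm_sq (\<lambda>x. F x - c) = L2_norm_sq F - (norm c)\<^sup>2"
    using L2_norm_sq_minus_mode[OF square_integrable_continuous[OF cont], of 0] c by simp
  ultimately show ?thesis by (simp add: c_def)
qed

text \<open>
  Modes are removed one at a time; by orthogonality this does not change the remaining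
  coefficients. The identity, not only the inequality, is needed: it shows that the Fourier
  series of the sawtooth function converges in mean square.
\<close>

lemma Bessel_identity:
  assumes h: "square_integrable h" and R: "finite R"
  shows "L2_norm_sq (\<lambda>x. h x - (\<Sum>r\<in>R. osc_integral r h * osc (-r) x)) = L2_norm_sq h - (\<Sum>r\<in>R. (norm (osc_integral r h))\<^sup>2)"
proof -
  define S where "S R x = (\<Sum>r\<in>R. osc_integral r h * osc (-r) x)" for R x
  have S_int: "square_integrable (S R)" for R
    unfolding S_def[abs_def] by (intro square_integrable_continuous continuous_intros)
  have coeff: "osc_integral q (S R) = 0" if "finite R" "q \<notin> R" for q R
  proof -
    have "S R x * osc q x = (\<Sum>r\<in>R. osc_integral r h * osc (q - r) x)" for x
      by (simp add: S_def sum_distrib_right mult.assoc osc_add[symmetric] add.commute)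
    then have "osc_integral q (S R) = (\<Sum>r\<in>R. osc_integral r h * (LINT x|unit_measure. osc (q - r) x))"
      unfolding osc_integral_eq by (simp add: continuous_integrable_unit continuous_on_osc)
    also have "\<dots> = 0" using that by (intro sum.neutral) (auto simp: integral_osc)
    finally show ?thesis .
  qed
  have "L2_norm_sq (\<lambda>x. h x - S R x) = L2_norm_sq h - (\<Sum>r\<in>R. (norm (osc_integral r h))\<^sup>2)"
    using R
  proof (induction R)
    case empty
    show ?case by (simp add: S_def)
  next
    case (insert q R)
    have q: "osc_integral q (\<lambda>x. h x - S R x) = osc_integral q h"
      using insert coeff by (simp add: osc_integral_diff[OF h S_int])
    have "(\<lambda>x. h x - S (insert q R) x) = (\<lambda>x. (h x - S R x) - osc_integral q h * osc (-q) x)"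
      using insert by (simp add: S_def fun_eq_iff)
    then have "L2_norm_sq (\<lambda>x. h x - S (insert q R) x) = L2_norm_sq (\<lambda>x. h x - S R x) - (norm (osc_integral q h))\<^sup>2"
      using L2_norm_sq_minus_mode[OF square_integrable_diff[OF h S_int[of R]], of q] q by simp
    then show ?case using insert by simp
  qed
  then show ?thesis by (simp add: S_def)
qed

lemma Bessel_inequality:
  assumes "square_integrable h" "finite R"
  shows "(\<Sum>r\<in>R. (norm (osc_integral r h))\<^sup>2) \<le> L2_norm_sq h"
  using Bessel_identity[OF assms] L2_norm_sq_nonneg[of "\<lambda>x. h x - (\<Sum>r\<in>R. osc_integral r h * osc (-r) x)"]
  by linarith

section \<open>Bernoulli polynomials\<close>

lemma poly_antiderivative:
  fixes p :: "real poly"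
  obtains P where "pderiv P = p"
proof
  show "pderiv (\<Sum>i\<le>degree p. monom (coeff p i / real (Suc i)) (Suc i)) = p"
    using higher_pderiv_sum[of 1 "\<lambda>i. monom (coeff p i / real (Suc i)) (Suc i)"]
    by (simp add: pderiv_monom poly_as_sum_of_monoms del: of_nat_Suc)
qed

lemma poly_set_integral:
  fixes P :: "real poly"
  assumes "a \<le> b"
  shows "(LINT x:{a..b}|lebesgue. poly (pderiv P) x) = poly P b - poly P a"
proof -
  have "poly (pderiv P) absolutely_integrable_on {a..b}"
    by (intro absolutely_integrable_continuous_real continuous_intros)
  then have "(LINT x:{a..b}|lebesgue. poly (pderiv P) x) = integral {a..b} (poly (pderiv P))"
    by (rule set_lebesgue_integral_eq_integral(2))
  moreover have "(poly (pderiv P) has_integral poly P b - poly P a) {a..b}"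
    using assms
    by (intro fundamental_theorem_of_calculus)
       (auto simp: has_real_derivative_iff_has_vector_derivative[symmetric] intro: DERIV_subset[OF poly_DERIV])
  ultimately show ?thesis by (simp add: integral_unique)
qed

text \<open>
  A periodic polynomial takes its value at \<open>0\<close> at all natural numbers. This is the uniqueness
  of Bernoulli polynomials.
\<close>

lemma poly_periodic_imp_const:
  fixes D :: "real poly"
  assumes "\<And>t. poly D (t + 1) = poly D t"
  shows "pderiv D = 0"
proof -
  have "poly D (real n) = poly D 0" for n
    by (induction n) (simp_all add: assms add.commute[of 1])
  then have sub: "range real \<subseteq> {x. poly (D - [:poly D 0:]) x = 0}" by auto
  have "infinite (range real)"
    by (rule range_inj_infinite) (simp add: inj_on_def)
  then have "D - [:poly D 0:] = 0"
    using sub poly_roots_finite finite_subset by blast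
  then have "pderiv (D - [:poly D 0:]) = 0" by simp
  then show ?thesis by (simp add: pderiv_diff pderiv_pCons)
qed

text \<open>
  An antiderivative of \<open>(m + 1) Q\<close>, corrected by a linear term, solves the equation for
  \<open>m + 1\<close>: the derivative of the difference is right by induction, and the linear term makes
  the value at \<open>t = 0\<close> right. The derivative of the solution is the Bernoulli polynomial.
\<close>

lemma difference_equation_power:
  "\<exists>Q :: real poly. \<forall>t. poly Q (t + 1) - poly Q t = t ^ m"
proof (induction m)
  case 0
  show ?case by (rule exI[of _ "[:0, 1:]"]) simp
next
  case (Suc m)
  then obtain Q :: "real poly" where Q: "\<And>t. poly Q (t + 1) - poly Q t = t ^ m" by blast
  obtain R where R: "pderiv R = smult (real (Suc m)) Q" by (rule poly_antiderivative)
  define Q' where "Q' = R - [:0, poly R 1 - poly R 0:]"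
  define h where "h t = poly Q' (t + 1) - poly Q' t - t ^ Suc m" for t
  have dQ': "pderiv Q' = smult (real (Suc m)) Q - [:poly R 1 - poly R 0:]"
    by (simp add: Q'_def pderiv_diff R pderiv_pCons del: of_nat_Suc)
  have "(h has_real_derivative 0) (at t)" for t
  proof -
    have "(h has_real_derivative poly (pderiv Q') (t + 1) - poly (pderiv Q') t - real (Suc m) * t ^ m) (at t)"
      unfolding h_def[abs_def]
      by (rule derivative_eq_intros refl | simp)+
    moreover have "poly (pderiv Q') (t + 1) - poly (pderiv Q') t = real (Suc m) * (poly Q (t + 1) - poly Q t)"
      unfolding dQ' by (simp add: algebra_simps del: of_nat_Suc)
    ultimately show ?thesis using Q[of t] by simp
  qed
  then have "h t = h 0" for t
    by (intro DERIV_isconst_all) auto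
  moreover have "h 0 = 0" by (simp add: h_def Q'_def)
  ultimately have "\<forall>t. poly Q' (t + 1) - poly Q' t = t ^ Suc m" by (simp add: h_def)
  then show ?case by blast
qed

text \<open>
  Bernoulli polynomials are defined through a description operator; in terms of an
  antiderivative \<open>Q\<close> the defining integral condition becomes a difference equation.
\<close>

lemma bernoulli_poly_unique:
  assumes "\<And>t. poly Q (t + 1) - poly Q t = t ^ m"
  shows "bernoulli_poly m = pderiv Q"
  unfolding bernoulli_poly_def
proof (rule the_equality)
  show "\<forall>t. (LINT x:{t..t+1}|lebesgue. poly (pderiv Q) x) = t ^ m"
    using assms by (simp add: poly_set_integral)
next
  fix p :: "real poly" assume p: "\<forall>t. (LINT x:{t..t+1}|lebesgue. poly p x) = t ^ m"
  obtain P where P: "pderiv P = p" by (rule poly_antiderivative)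
  have dP: "poly P (t + 1) - poly P t = t ^ m" for t
    using p unfolding P[symmetric] by (simp add: poly_set_integral)
  then have "pderiv (P - Q) = 0"
  proof (intro poly_periodic_imp_const)
    show "poly (P - Q) (t + 1) = poly (P - Q) t" for t
      using dP[of t] assms[of t] by (simp only: poly_diff)
  qed
  then show "p = pderiv Q" by (simp add: pderiv_diff P)
qed

lemma bernoulli_poly_difference:
  "poly (bernoulli_poly m) (t + 1) - poly (bernoulli_poly m) t = real m * t ^ (m - 1)"
proof -
  obtain Q :: "real poly" where Q: "\<And>t. poly Q (t + 1) - poly Q t = t ^ m"
    using difference_equation_power by blast
  have "((\<lambda>t. poly Q (t + 1) - poly Q t) has_real_derivative
      poly (pderiv Q) (t + 1) - poly (pderiv Q) t) (at t)"
    by (rule derivative_eq_intros refl | simp)+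
  moreover have "((\<lambda>t. poly Q (t + 1) - poly Q t) has_real_derivative real m * t ^ (m - 1)) (at t)"
    unfolding Q by (rule derivative_eq_intros refl | simp)+
  ultimately show ?thesis
    unfolding bernoulli_poly_unique[OF Q] by (rule DERIV_unique)
qed

lemma pderiv_bernoulli_poly: "pderiv (bernoulli_poly (Suc m)) = smult (real (Suc m)) (bernoulli_poly m)"
proof -
  have "bernoulli_poly m = pderiv (smult (1 / real (Suc m)) (bernoulli_poly (Suc m)))"
  proof (rule bernoulli_poly_unique)
    fix t :: real
    show "poly (smult (1 / real (Suc m)) (bernoulli_poly (Suc m))) (t + 1) -
      poly (smult (1 / real (Suc m)) (bernoulli_poly (Suc m))) t = t ^ m"
      using bernoulli_poly_difference[of "Suc m" t]
      by (simp add: field_simps del: of_nat_Suc)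
  qed
  then show ?thesis by (simp add: pderiv_smult del: of_nat_Suc)
qed

lemma bernoulli_poly_0: "bernoulli_poly 0 = 1"
  using bernoulli_poly_unique[of "[:0, 1:]" 0] by (simp add: pderiv_pCons one_pCons)

lemma bernoulli_normalized_0 [simp]: "bernoulli_normalized 0 x = 1"
  by (simp add: bernoulli_normalized_def bernoulli_poly_0)

text \<open>
  This makes \<open>f - bernoulli_part f s\<close> periodic. In the recursion for the Fourier coefficients
  it leaves a boundary term at the linear polynomial only.
\<close>

lemma bernoulli_normalized_jump:
  "bernoulli_normalized (Suc m) 1 - bernoulli_normalized (Suc m) 0 = (if m = 0 then 1 else 0)"
  using bernoulli_poly_difference[of "Suc m" 0]
  by (simp add: bernoulli_normalized_def diff_divide_distrib[symmetric] del: of_nat_Suc)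

lemma bernoulli_normalized_has_L2_derivative:
  "has_L2_derivative (\<lambda>x. of_real (bernoulli_normalized (Suc m) x)) (\<lambda>x. of_real (bernoulli_normalized m x))"
proof (rule has_L2_derivative_C1)
  fix x :: real
  have "(bernoulli_normalized (Suc m) has_real_derivative bernoulli_normalized m x) (at x within {0..1})"
  proof -
    have "(bernoulli_normalized (Suc m) has_real_derivative
        poly (pderiv (bernoulli_poly (Suc m))) x / fact (Suc m)) (at x within {0..1})"
      unfolding bernoulli_normalized_def[abs_def]
      by (intro DERIV_cdivide DERIV_subset[OF poly_DERIV]) auto
    then show ?thesis
      by (simp add: pderiv_bernoulli_poly bernoulli_normalized_def field_simps del: of_nat_Suc)
  qed
  then show "((\<lambda>x. of_real (bernoulli_normalized (Suc m) x)) has_vector_derivative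
      complex_of_real (bernoulli_normalized m x)) (at x within {0..1})"
    by (intro has_vector_derivative_of_real) (simp add: has_real_derivative_iff_has_vector_derivative)
next
  show "continuous_on {0..1} (\<lambda>x. complex_of_real (bernoulli_normalized m x))"
    unfolding bernoulli_normalized_def[abs_def] by (intro continuous_intros) auto
qed

section \<open>Fourier coefficients after removal of the Bernoulli part\<close>

text \<open>
  The eigenvalue of differentiation for the frequency \<open>k\<close>, not the frequency itself.
\<close>

abbreviation freq :: "int \<Rightarrow> complex" where
  "freq k \<equiv> 2 * of_real pi * \<i> * of_int k"

lemma norm_freq: "norm (freq k) = 2 * pi * \<bar>real_of_int k\<bar>"
  by (simp add: norm_mult)

lemma osc_integral_bernoulli:
  assumes "k \<noteq> 0"
  shows "osc_integral k (\<lambda>x. of_real (bernoulli_normalized (Suc m) x)) = - 1 / freq k ^ Suc m"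
proof (induction m)
  case 0
  have "osc_integral k (\<lambda>x. of_real (bernoulli_normalized 0 x)) = 0"
    using assms by (simp add: osc_integral_eq integral_osc)
  with osc_integral_derivative[OF bernoulli_normalized_has_L2_derivative, of k 0]
    bernoulli_normalized_jump[of 0]
  have "0 = 1 + freq k * osc_integral k (\<lambda>x. of_real (bernoulli_normalized (Suc 0) x))"
    by (simp flip: of_real_diff)
  then show ?case using assms by (simp add: field_simps add_eq_0_iff)
next
  case (Suc m)
  have "- 1 / freq k ^ Suc m = freq k * osc_integral k (\<lambda>x. of_real (bernoulli_normalized (Suc (Suc m)) x))"
    using osc_integral_derivative[OF bernoulli_normalized_has_L2_derivative, of k "Suc m"]
      bernoulli_normalized_jump[of "Suc m"] Suc.IH
    by (simp flip: of_real_diff)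
  then show ?case using assms by (simp add: field_simps)
qed

text \<open>
  These are precisely the boundary terms that repeated integration by parts produces for \<open>f\<close>,
  so that they cancel in \<open>f - bernoulli_part f j\<close>.
\<close>

lemma osc_integral_bernoulli_part:
  assumes "k \<noteq> 0"
  shows "osc_integral k (bernoulli_part f j) = - (\<Sum>m<j. (hderiv m f 1 - hderiv m f 0) / freq k ^ Suc m)"
proof -
  have int: "integrable unit_measure (\<lambda>x. of_real (bernoulli_normalized (Suc m) x) * osc k x)" for m
    by (intro square_integrable_product square_integrable_continuous continuous_on_osc
        has_L2_derivative_continuous[OF bernoulli_normalized_has_L2_derivative])
  have "bernoulli_part f j x * osc k x =
    (\<Sum>m<j. (hderiv m f 1 - hderiv m f 0) * (of_real (bernoulli_normalized (Suc m) x) * osc k x))" for x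
    by (simp add: bernoulli_part_def sum_distrib_right mult.assoc)
  then have "osc_integral k (bernoulli_part f j) =
     (\<Sum>m<j. (hderiv m f 1 - hderiv m f 0) * osc_integral k (\<lambda>x. of_real (bernoulli_normalized (Suc m) x)))"
    unfolding osc_integral_eq using int by simp
  also have "\<dots> = (\<Sum>m<j. - ((hderiv m f 1 - hderiv m f 0) / freq k ^ Suc m))"
    by (intro sum.cong refl) (simp add: osc_integral_bernoulli[OF assms])
  finally show ?thesis by (simp add: sum_negf)
qed

lemma osc_integral_repeated_derivative:
  assumes "k \<noteq> 0" and h: "\<And>l. l < j \<Longrightarrow> has_L2_derivative (h l) (h (Suc l))"
  shows "osc_integral k (h 0) = osc_integral k (h j) / freq k ^ j - (\<Sum>m<j. (h m 1 - h m 0) / freq k ^ Suc m)"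
  using h
proof (induction j)
  case (Suc j)
  have "osc_integral k (h j) = (osc_integral k (h (Suc j)) - (h j 1 - h j 0)) / freq k"
    using osc_integral_derivative[OF Suc.prems[of j], of k] assms(1) by (simp add: field_simps)
  then show ?case
    using Suc by (simp add: diff_divide_distrib)
qed simp

text \<open>
  Below order \<open>s - 1\<close> the derivatives are continuously differentiable. At order \<open>s - 1\<close> only
  absolute continuity is known; it makes \<open>hderiv s f\<close> a genuine derivative almost everywhere,
  although it is defined by a description operator whose value is unspecified at the
  exceptional points.
\<close>

lemma Hs_has_L2_derivative:
  assumes f: "f \<in> Hs s" and l: "l < s"
  shows "has_L2_derivative (hderiv l f) (hderiv (Suc l) f)"
proof -
  have diff: "(hderiv l f has_vector_derivative hderiv (Suc l) f x) (at x within {0..1})"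
    if "l < s - 1" "x \<in> {0..1}" for l x
    using f that vector_derivative_works[of "hderiv l f" "at x within {0..1}"]
    by (auto simp: Hs_def)
  have ac: "abs_continuous (hderiv (s - 1) f)"
    using f by (simp add: Hs_def abs_cont_on_iff_abs_continuous)
  have cont: "continuous_on {0..1} (hderiv l f)" if "l \<le> s - 1" for l
  proof (cases "l = s - 1")
    case True
    then show ?thesis using ac abs_continuous_imp_continuous_on by simp
  next
    case False
    then have "l < s - 1" using that by simp
    then show ?thesis
      unfolding continuous_on_eq_continuous_within
      by (intro ballI has_vector_derivative_continuous[OF diff])
  qed
  show ?thesis
  proof (cases "l < s - 1")
    case True
    then show ?thesis by (intro has_L2_derivative_C1 diff cont) auto
  next
    case False
    then have ls: "l = s - 1" "Suc l = s" using l by auto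
    obtain N where N: "negligible N" "\<And>x. x \<in> {0..1} - N \<Longrightarrow> hderiv l f differentiable (at x)"
      using abs_continuous_differentiable_ae[of "hderiv l f"] ac ls(1) by blast
    have "(hderiv l f has_vector_derivative hderiv (Suc l) f x) (at x within {0..1})" if "x \<in> {0..1} - N" for x
    proof -
      have "hderiv l f differentiable (at x within {0..1})"
        using N(2)[OF that] differentiable_at_withinI by blast
      then show ?thesis by (simp add: vector_derivative_works)
    qed
    moreover have "square_integrable (hderiv (Suc l) f)"
      using f unfolding ls(2) Hs_def square_integrable_def
      by (simp add: set_borel_measurable_unit set_integrable_unit)
    moreover have "abs_continuous (hderiv l f)" using ac ls(1) by simp
    ultimately show ?thesis
      using N(1) unfolding has_L2_derivative_def by blast
  qed
qed

lemma Hs_norm_eq: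
  "Hs_norm s f = sqrt ((\<Sum>l<s. (norm (LINT x|unit_measure. hderiv l f x))\<^sup>2) + L2_norm_sq (hderiv s f))"
proof -
  have "(LINT x|unit_measure. hderiv s f x * cnj (hderiv s f x)) = of_real (L2_norm_sq (hderiv s f))"
    unfolding L2_norm_sq_def complex_norm_square[symmetric] by (rule integral_complex_of_real)
  then have "Hs_inner s f f = of_real ((\<Sum>l<s. (norm (LINT x|unit_measure. hderiv l f x))\<^sup>2) + L2_norm_sq (hderiv s f))"
    by (simp add: Hs_inner_def set_integral_unit complex_norm_square[symmetric] del: hderiv.simps)
  then show ?thesis by (simp add: Hs_norm_def)
qed

text \<open>
  Poincare's inequality, iterated downwards from order \<open>s\<close>: each step pays one of the squared
  means that occur in the norm of \<open>Hs s\<close>.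
\<close>

lemma L2_norm_sq_hderiv_le:
  assumes f: "f \<in> Hs s" and j: "j \<le> s" and n: "Hs_norm s f \<le> 1"
  shows "L2_norm_sq (hderiv j f) \<le> 1"
proof -
  define a where "a l = (norm (LINT x|unit_measure. hderiv l f x))\<^sup>2" for l
  have "L2_norm_sq (hderiv j f) \<le> (\<Sum>l=j..<s. a l) + L2_norm_sq (hderiv s f)"
    using j
  proof (induction j rule: inc_induct)
    case (step j)
    have "L2_norm_sq (hderiv j f) \<le> a j + L2_norm_sq (hderiv (Suc j) f)"
      unfolding a_def by (rule Poincare_inequality[OF Hs_has_L2_derivative[OF f \<open>j < s\<close>]])
    then show ?case using step by (simp add: sum.atLeast_Suc_lessThan)
  qed simp
  also have "(\<Sum>l=j..<s. a l) \<le> (\<Sum>l<s. a l)"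
    by (intro sum_mono2) (auto simp: a_def)
  also have "(\<Sum>l<s. a l) + L2_norm_sq (hderiv s f) \<le> 1"
    using n by (simp add: Hs_norm_eq a_def)
  finally show ?thesis by simp
qed

lemma norm_osc_integral_le:
  assumes "square_integrable h"
  shows "norm (osc_integral k h) \<le> sqrt (L2_norm_sq h)"
  using Bessel_inequality[OF assms, of "{k}"] real_le_rsqrt by simp

lemma Hs_square_integrable_hderiv:
  assumes "f \<in> Hs s" "s \<ge> 1" "j \<le> s"
  shows "square_integrable (hderiv j f)"
proof (cases j)
  case 0
  then show ?thesis
    using Hs_has_L2_derivative[of f s 0] assms has_L2_derivative_continuous square_integrable_continuous
    by auto
next
  case (Suc l)
  then show ?thesis
    using Hs_has_L2_derivative[of f s l] assms by (auto simp: has_L2_derivative_def simp del: hderiv.simps)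
qed

lemma osc_integral_minus_bernoulli_part:
  assumes f: "f \<in> Hs s" and "j \<le> s" "k \<noteq> 0"
  shows "osc_integral k f - osc_integral k (bernoulli_part f j) = osc_integral k (hderiv j f) / freq k ^ j"
  using osc_integral_repeated_derivative[OF \<open>k \<noteq> 0\<close>, of j "\<lambda>l. hderiv l f"]
    Hs_has_L2_derivative[OF f] \<open>j \<le> s\<close> osc_integral_bernoulli_part[OF \<open>k \<noteq> 0\<close>, of f j]
  by simp

text \<open>
  The error bound whenever no function value is used: the information consists of the \<open>j\<close>
  boundary terms only.
\<close>

lemma osc_integral_minus_bernoulli_part_le:
  assumes f: "f \<in> Hs s" "Hs_norm s f \<le> 1" and "s \<ge> 1" "j \<le> s" "k \<noteq> 0"
  shows "norm (osc_integral k f - osc_integral k (bernoulli_part f j)) \<le> 1 / (2 * pi * \<bar>real_of_int k\<bar>) ^ j"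
proof -
  have "norm (osc_integral k (hderiv j f)) \<le> sqrt (L2_norm_sq (hderiv j f))"
    by (rule norm_osc_integral_le[OF Hs_square_integrable_hderiv[OF f(1) assms(3,4)]])
  also have "\<dots> \<le> 1" using L2_norm_sq_hderiv_le[OF f(1) assms(4) f(2)] by simp
  finally show ?thesis
    unfolding osc_integral_minus_bernoulli_part[OF f(1) assms(4,5)] norm_divide norm_power norm_freq
    using assms(5) by (intro divide_right_mono) auto
qed

section \<open>The sawtooth kernel and aliasing\<close>

lemma has_integral_unit_pieces:
  fixes f :: "real \<Rightarrow> 'a::banach"
  assumes N: "N \<ge> 1"
    and f: "\<And>j. j < N \<Longrightarrow> (f has_integral I j) {real j / real N..real (Suc j) / real N}"
  shows "(f has_integral (\<Sum>j<N. I j)) {0..1}"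
proof -
  have "(f has_integral (\<Sum>j<n. I j)) {0..real n / real N}" if "n \<le> N" for n
    using that
  proof (induction n)
    case (Suc n)
    have "(f has_integral ((\<Sum>j<n. I j) + I n)) {0..real (Suc n) / real N}"
      using Suc N by (intro has_integral_combine[OF _ _ Suc.IH f]) (auto simp: field_simps)
    then show ?case by simp
  qed (use has_integral_refl(1)[of f "0::real"] in simp)
  from this[of N] show ?thesis using N by simp
qed

text \<open>
  The 1-periodic extension of the Bernoulli polynomial of degree one, at \<open>N t\<close>. Up to the
  factor \<open>1 / N\<close> it is the Peano kernel of the \<open>N\<close>-point rectangle rule for periodic
  functions.
\<close>

definition sawtooth :: "nat \<Rightarrow> real \<Rightarrow> real" where
  "sawtooth N t = frac (real N * t) - 1 / 2"

text \<open>
  The right endpoint of each piece is excluded because the function jumps there; under an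
  integral one point is irrelevant.
\<close>

lemma sawtooth_eq:
  assumes "N \<ge> 1" "t \<in> {real j / real N..real (Suc j) / real N} - {real (Suc j) / real N}"
  shows "sawtooth N t = real N * t - real j - 1 / 2"
proof -
  have "real j \<le> real N * t" "real N * t < real j + 1"
    using assms by (auto simp: field_simps)
  then have "\<lfloor>real N * t\<rfloor> = int j" by (intro floor_unique) auto
  then show ?thesis by (simp add: sawtooth_def frac_def)
qed

lemma sawtooth_measurable [measurable]: "sawtooth N \<in> borel_measurable unit_measure"
proof -
  have "sawtooth N \<in> borel_measurable borel"
    unfolding sawtooth_def[abs_def] frac_def by measurable
  then have "sawtooth N \<in> borel_measurable lebesgue" by (intro measurable_completion) simp
  then show ?thesis by (rule measurable_restrict_space1)
qed

lemma square_integrable_mult_sawtooth: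
  assumes "square_integrable f"
  shows "square_integrable (\<lambda>x. f x * of_real (sawtooth N x))"
proof (rule square_integrable_bounded_mult[OF assms])
  show "norm (complex_of_real (sawtooth N x)) \<le> 1" for x
    unfolding norm_of_real sawtooth_def
    using frac_ge_0[of "real N * x"] frac_lt_1[of "real N * x"] by linarith
qed measurable

lemma square_integrable_sawtooth: "square_integrable (\<lambda>x. of_real (sawtooth N x))"
  using square_integrable_mult_sawtooth[of "\<lambda>_. 1" N] by simp

lemma L2_norm_sq_sawtooth:
  assumes N: "N \<ge> 1"
  shows "L2_norm_sq (\<lambda>x. of_real (sawtooth N x)) = 1 / 12"
proof -
  have "((\<lambda>t. (norm (complex_of_real (sawtooth N t)))\<^sup>2) has_integral 1 / (12 * real N))
     {real j / real N..real (Suc j) / real N}" for j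
  proof (rule has_integral_spike_finite[of "{real (Suc j) / real N}" _ _ "\<lambda>t. (real N * t - real j - 1 / 2)\<^sup>2"])
    have "((\<lambda>t. (real N * t - real j - 1 / 2)\<^sup>2) has_integral
        ((real N * (real (Suc j) / real N) - real j - 1 / 2) ^ 3 / (3 * real N) -
         (real N * (real j / real N) - real j - 1 / 2) ^ 3 / (3 * real N))) {real j / real N..real (Suc j) / real N}"
    proof (rule fundamental_theorem_of_calculus)
      fix x
      show "((\<lambda>t. (real N * t - real j - 1 / 2) ^ 3 / (3 * real N)) has_vector_derivative (real N * x - real j - 1 / 2)\<^sup>2)
          (at x within {real j / real N..real (Suc j) / real N})"
        unfolding has_real_derivative_iff_has_vector_derivative[symmetric] using N
        by (auto intro!: derivative_eq_intros simp: field_simps)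
    qed (use N in \<open>simp add: field_simps\<close>)
    then show "((\<lambda>t. (real N * t - real j - 1 / 2)\<^sup>2) has_integral 1 / (12 * real N)) {real j / real N..real (Suc j) / real N}"
      using N by (simp add: power3_eq_cube field_simps)
  next
    show "(norm (complex_of_real (sawtooth N x)))\<^sup>2 = (real N * x - real j - 1 / 2)\<^sup>2"
      if "x \<in> {real j / real N..real (Suc j) / real N} - {real (Suc j) / real N}" for x
      unfolding norm_of_real power2_abs sawtooth_eq[OF N that] ..
  qed simp
  then have "((\<lambda>t. (norm (complex_of_real (sawtooth N t)))\<^sup>2) has_integral (\<Sum>j<N. 1 / (12 * real N))) {0..1}"
    by (intro has_integral_unit_pieces[OF N])
  moreover have "((\<lambda>t. (norm (complex_of_real (sawtooth N t)))\<^sup>2) has_integral L2_norm_sq (\<lambda>x. of_real (sawtooth N x))) {0..1}"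
    unfolding L2_norm_sq_def using square_integrable_sawtooth[of N]
    by (intro has_integral_integral_lebesgue_on) (auto simp: square_integrable_def)
  ultimately have "L2_norm_sq (\<lambda>x. of_real (sawtooth N x)) = (\<Sum>j<N. 1 / (12 * real N))"
    by (rule has_integral_unique[rotated])
  then show ?thesis using N by simp
qed

text \<open>
  Euler-Maclaurin of first order: on each of the \<open>N\<close> pieces the kernel is an affine function
  with values \<open>-1/2\<close> and \<open>1/2\<close> at the ends, so integration by parts gives the trapezoidal
  rule, which for periodic \<open>u\<close> is the rectangle rule.
\<close>

lemma sawtooth_quadrature:
  assumes N: "N \<ge> 1" and u: "has_L2_derivative u u'" and per: "u 0 = u 1"
  shows "(LINT x|unit_measure. u' x * of_real (sawtooth N x)) =
    (\<Sum>j=1..N. u (real j / real N)) - of_nat N * (LINT x|unit_measure. u x)"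
proof -
  have sq: "square_integrable u'" using u by (simp add: has_L2_derivative_def)
  define h where "h x = u x * of_nat N + u' x * of_real (sawtooth N x)" for x
  have int1: "integrable unit_measure u"
    using has_L2_derivative_continuous[OF u] by (rule continuous_integrable_unit)
  have int2: "integrable unit_measure (\<lambda>x. u' x * of_real (sawtooth N x))"
    by (rule square_integrable_integrable[OF square_integrable_mult_sawtooth[OF sq]])
  have "(h has_integral (u (real j / real N) + u (real (Suc j) / real N)) / 2)
     {real j / real N..real (Suc j) / real N}" if j: "j < N" for j
  proof (rule has_integral_spike_finite[of "{real (Suc j) / real N}" _ _
        "\<lambda>x. u x * of_nat N + u' x * (of_nat N * of_real x - of_nat j - 1 / 2)"])
    define v where "v x = (of_nat N * of_real x - of_nat j - 1 / 2 :: complex)" for x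
    have v: "has_L2_derivative v (\<lambda>x. of_nat N)"
    proof (rule has_L2_derivative_C1)
      fix x :: real
      have "((\<lambda>z. of_nat N * z - of_nat j - 1 / 2 :: complex) has_field_derivative of_nat N) (at (of_real x))"
        by (auto intro!: derivative_eq_intros)
      from has_vector_derivative_real_field[OF this]
      show "(v has_vector_derivative of_nat N) (at x within {0..1})"
        unfolding v_def[abs_def] by (rule has_vector_derivative_at_within)
    qed simp
    have "has_L2_derivative (\<lambda>x. u x * v x) (\<lambda>x. u x * of_nat N + u' x * v x)"
      by (rule has_L2_derivative_mult[OF u v]) simp
    from has_L2_derivative_FTC[OF this, of "real j / real N" "real (Suc j) / real N"]
    have "((\<lambda>x. u x * of_nat N + u' x * v x) has_integral
       u (real (Suc j) / real N) * v (real (Suc j) / real N) - u (real j / real N) * v (real j / real N))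
       {real j / real N..real (Suc j) / real N}"
      using j by (simp add: field_simps)
    moreover have v: "v (real (Suc j) / real N) = 1 / 2" "v (real j / real N) = - 1 / 2"
      using N by (simp_all add: v_def)
    have "u (real (Suc j) / real N) * v (real (Suc j) / real N) - u (real j / real N) * v (real j / real N) =
       (u (real j / real N) + u (real (Suc j) / real N)) / 2"
      unfolding v by (simp add: add_divide_distrib)
    ultimately show "((\<lambda>x. u x * of_nat N + u' x * (of_nat N * of_real x - of_nat j - 1 / 2)) has_integral
      (u (real j / real N) + u (real (Suc j) / real N)) / 2) {real j / real N..real (Suc j) / real N}"
      by (simp only: v_def)
  next
    show "h x = u x * of_nat N + u' x * (of_nat N * of_real x - of_nat j - 1 / 2)"
      if "x \<in> {real j / real N..real (Suc j) / real N} - {real (Suc j) / real N}" for x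
      unfolding h_def sawtooth_eq[OF N that] by simp
  qed simp
  then have "(h has_integral (\<Sum>j<N. (u (real j / real N) + u (real (Suc j) / real N)) / 2)) {0..1}"
    by (rule has_integral_unit_pieces[OF N])
  moreover have "(h has_integral (LINT x|unit_measure. h x)) {0..1}"
    unfolding h_def using int1 int2 by (intro has_integral_integral_lebesgue_on) auto
  ultimately have "(LINT x|unit_measure. h x) = (\<Sum>j<N. (u (real j / real N) + u (real (Suc j) / real N)) / 2)"
    by (metis has_integral_unique)
  also have "\<dots> = ((\<Sum>j<N. u (real j / real N)) + (\<Sum>j<N. u (real (Suc j) / real N))) / 2"
    by (simp add: sum_divide_distrib[symmetric] sum.distrib)
  also have "(\<Sum>j<N. u (real j / real N)) = (\<Sum>j<N. u (real (Suc j) / real N))"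
    using sum_lessThan_telescope[of "\<lambda>j. u (real j / real N)" N] per N
    by (simp add: sum_subtractf)
  also have "(\<Sum>j<N. u (real (Suc j) / real N)) = (\<Sum>j=1..N. u (real j / real N))"
    by (simp add: sum.atLeast1_atMost_eq)
  finally show ?thesis
    unfolding h_def using int1 int2 by (simp add: algebra_simps)
qed

lemma osc_multiple_at_node: "N \<ge> 1 \<Longrightarrow> osc (m * int N) (real j / real N) = 1"
proof -
  assume N: "N \<ge> 1"
  have "osc (m * int N) (real j / real N) = osc (m * int j) 1"
    using N by (simp add: osc_def mult_ac)
  then show ?thesis by simp
qed

text \<open>
  Applied to \<open>u = osc (m N)\<close>, which is \<open>1\<close> at every node and has mean zero, the quadrature
  formula yields the coefficient itself.
\<close>

lemma osc_integral_sawtooth: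
  assumes N: "N \<ge> 1" and m: "m \<noteq> 0"
  shows "osc_integral (m * int N) (\<lambda>x. of_real (sawtooth N x)) = - 1 / freq m"
proof -
  have "(LINT x|unit_measure. (- freq (m * int N) * osc (m * int N) x) * of_real (sawtooth N x)) =
    (\<Sum>j=1..N. osc (m * int N) (real j / real N)) - of_nat N * (LINT x|unit_measure. osc (m * int N) x)"
    by (rule sawtooth_quadrature[OF N osc_has_L2_derivative]) simp
  also have "\<dots> = of_nat N"
    using N m by (simp add: osc_multiple_at_node integral_osc)
  also have "(LINT x|unit_measure. (- freq (m * int N) * osc (m * int N) x) * of_real (sawtooth N x)) =
     (LINT x|unit_measure. - freq (m * int N) * (of_real (sawtooth N x) * osc (m * int N) x))"
    by (simp only: mult_ac)
  also have "\<dots> = - freq (m * int N) * osc_integral (m * int N) (\<lambda>x. of_real (sawtooth N x))"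
    unfolding osc_integral_eq by (rule integral_mult_right_zero)
  finally have "of_nat N * (- freq m * osc_integral (m * int N) (\<lambda>x. of_real (sawtooth N x))) = of_nat N * 1"
    by (simp add: mult_ac)
  then have "- freq m * osc_integral (m * int N) (\<lambda>x. of_real (sawtooth N x)) = 1"
    using N by (subst (asm) mult_left_cancel) auto
  then show ?thesis using m by (metis minus_divide_left minus_equation_iff mult_minus_left nonzero_mult_div_cancel_left mult_eq_0_iff zero_neq_one)
qed

definition sym_freqs :: "nat \<Rightarrow> int set" where
  "sym_freqs M = {- int M..int M} - {0}"

lemma finite_sym_freqs [simp]: "finite (sym_freqs M)"
  by (simp add: sym_freqs_def)

lemma sum_sym_freqs:
  fixes g :: "int \<Rightarrow> 'a::comm_monoid_add"
  shows "(\<Sum>m\<in>sym_freqs M. g m) = (\<Sum>n<M. g (int (Suc n)) + g (- int (Suc n)))"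
proof (induction M)
  case 0
  have "sym_freqs 0 = {}" by (auto simp: sym_freqs_def)
  then show ?case by simp
next
  case (Suc M)
  have "sym_freqs (Suc M) = insert (int (Suc M)) (insert (- int (Suc M)) (sym_freqs M))"
    by (auto simp: sym_freqs_def)
  moreover have "int (Suc M) \<notin> insert (- int (Suc M)) (sym_freqs M)" "- int (Suc M) \<notin> sym_freqs M"
    by (auto simp: sym_freqs_def)
  ultimately show ?case using Suc by (simp add: add_ac)
qed

text \<open>
  By Bessel's identity the squared error is \<open>1/12 - (1 / (2 \<pi>\<^sup>2)) \<Sum> 1 / n\<^sup>2\<close>,
  which tends to zero by Euler's evaluation of the Basel sum.
\<close>

lemma sawtooth_Fourier_converges:
  assumes N: "N \<ge> 1"
  shows "(\<lambda>M. L2_norm_sq (\<lambda>x. of_real (sawtooth N x) -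
    (\<Sum>r\<in>(\<lambda>m. m * int N) ` sym_freqs M. osc_integral r (\<lambda>x. of_real (sawtooth N x)) * osc (- r) x))) \<longlonglongrightarrow> 0"
proof -
  have inj: "inj_on (\<lambda>m. m * int N) (sym_freqs M)" for M
    using N by (auto simp: inj_on_def)
  have "L2_norm_sq (\<lambda>x. of_real (sawtooth N x) -
    (\<Sum>r\<in>(\<lambda>m. m * int N) ` sym_freqs M. osc_integral r (\<lambda>x. of_real (sawtooth N x)) * osc (- r) x)) =
    1 / 12 - (1 / (2 * pi\<^sup>2)) * (\<Sum>n<M. 1 / (real n + 1)\<^sup>2)" for M
  proof -
    have "(\<Sum>r\<in>(\<lambda>m. m * int N) ` sym_freqs M. (norm (osc_integral r (\<lambda>x. of_real (sawtooth N x))))\<^sup>2) =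
      (\<Sum>m\<in>sym_freqs M. (norm (osc_integral (m * int N) (\<lambda>x. of_real (sawtooth N x))))\<^sup>2)"
      by (simp add: sum.reindex[OF inj])
    also have "\<dots> = (\<Sum>m\<in>sym_freqs M. 1 / (4 * pi\<^sup>2 * (real_of_int m)\<^sup>2))"
      using N by (intro sum.cong refl)
         (auto simp: osc_integral_sawtooth sym_freqs_def norm_divide norm_mult power_divide power_mult_distrib)
    also have "\<dots> = (\<Sum>n<M. (1 / (2 * pi\<^sup>2)) * (1 / (real n + 1)\<^sup>2))"
      unfolding sum_sym_freqs of_int_minus power2_minus of_int_of_nat_eq
      by (intro sum.cong refl) (simp add: field_simps)
    finally show ?thesis
      by (subst Bessel_identity) (simp_all add: square_integrable_sawtooth L2_norm_sq_sawtooth[OF N] sum_distrib_left)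
  qed
  moreover have "(\<lambda>M. 1 / 12 - (1 / (2 * pi\<^sup>2)) * (\<Sum>n<M. 1 / (real n + 1)\<^sup>2)) \<longlonglongrightarrow> 1 / 12 - (1 / (2 * pi\<^sup>2)) * (pi\<^sup>2 / 6)"
    using inverse_squares_sums unfolding sums_def by (intro tendsto_intros) (simp add: add.commute)
  ultimately show ?thesis by simp
qed

text \<open>
  The quadrature error is the integral of \<open>u'\<close> against the sawtooth function; inserting the
  Fourier series of the latter, which converges in mean square, turns it into the sum of the
  Fourier coefficients of \<open>u\<close> at the nonzero multiples of \<open>N\<close>.
\<close>

lemma aliasing:
  assumes N: "N \<ge> 1" and u: "has_L2_derivative u u'" and per: "u 0 = u 1"
  shows "(\<lambda>M. \<Sum>m\<in>sym_freqs M. osc_integral (- (m * int N)) u) \<longlonglongrightarrow>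
    (\<Sum>j=1..N. u (real j / real N)) / of_nat N - (LINT x|unit_measure. u x)"
proof -
  let ?\<beta> = "\<lambda>x. complex_of_real (sawtooth N x)"
  define S where "S M x = (\<Sum>r\<in>(\<lambda>m. m * int N) ` sym_freqs M. osc_integral r ?\<beta> * osc (- r) x)" for M x
  have sq: "square_integrable u'" using u by (simp add: has_L2_derivative_def)
  have S_sq: "square_integrable (S M)" for M
    unfolding S_def[abs_def] by (intro square_integrable_continuous continuous_intros)
  have inj: "inj_on (\<lambda>m. m * int N) (sym_freqs M)" for M
    using N by (auto simp: inj_on_def)
  have u'_osc: "integrable unit_measure (\<lambda>x. u' x * osc k x)" for k
    by (rule square_integrable_product[OF sq square_integrable_continuous[OF continuous_on_osc]])
  have uS: "(LINT x|unit_measure. u' x * S M x) = of_nat N * (\<Sum>m\<in>sym_freqs M. osc_integral (- (m * int N)) u)" for M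
  proof -
    have "u' x * S M x = (\<Sum>m\<in>sym_freqs M. osc_integral (m * int N) ?\<beta> * (u' x * osc (- (m * int N)) x))" for x
      by (simp add: S_def sum.reindex[OF inj] sum_distrib_left mult_ac)
    then have "(LINT x|unit_measure. u' x * S M x) =
       (\<Sum>m\<in>sym_freqs M. osc_integral (m * int N) ?\<beta> * osc_integral (- (m * int N)) u')"
      unfolding osc_integral_eq[of _ u'] using u'_osc by simp
    also have "\<dots> = (\<Sum>m\<in>sym_freqs M. of_nat N * osc_integral (- (m * int N)) u)"
    proof (intro sum.cong refl)
      fix m assume "m \<in> sym_freqs M"
      then have "m \<noteq> 0" by (simp add: sym_freqs_def)
      then show "osc_integral (m * int N) ?\<beta> * osc_integral (- (m * int N)) u' = of_nat N * osc_integral (- (m * int N)) u"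
        using osc_integral_derivative[OF u, of "- (m * int N)"] per
        by (simp add: osc_integral_sawtooth[OF N] field_simps)
    qed
    finally show ?thesis by (simp add: sum_distrib_left)
  qed
  have "(\<lambda>M. LINT x|unit_measure. u' x * (?\<beta> x - S M x)) \<longlonglongrightarrow> 0"
  proof (rule Lim_null_comparison)
    show "\<forall>\<^sub>F M in sequentially. norm (LINT x|unit_measure. u' x * (?\<beta> x - S M x)) \<le>
       sqrt (L2_norm_sq u') * sqrt (L2_norm_sq (\<lambda>x. ?\<beta> x - S M x))"
      by (intro always_eventually allI norm_integral_product_le sq square_integrable_diff
          square_integrable_sawtooth S_sq)
    have "(\<lambda>M. sqrt (L2_norm_sq u') * sqrt (L2_norm_sq (\<lambda>x. ?\<beta> x - S M x))) \<longlonglongrightarrow> sqrt (L2_norm_sq u') * sqrt 0"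
      using sawtooth_Fourier_converges[OF N] unfolding S_def by (intro tendsto_intros)
    then show "(\<lambda>M. sqrt (L2_norm_sq u') * sqrt (L2_norm_sq (\<lambda>x. ?\<beta> x - S M x))) \<longlonglongrightarrow> 0" by simp
  qed
  moreover have "(LINT x|unit_measure. u' x * (?\<beta> x - S M x)) =
    ((\<Sum>j=1..N. u (real j / real N)) - of_nat N * (LINT x|unit_measure. u x)) -
      of_nat N * (\<Sum>m\<in>sym_freqs M. osc_integral (- (m * int N)) u)" for M
    using square_integrable_product[OF sq S_sq] square_integrable_product[OF sq square_integrable_sawtooth]
    by (simp add: right_diff_distrib sawtooth_quadrature[OF N u per] uS)
  ultimately have "(\<lambda>M. ((\<Sum>j=1..N. u (real j / real N)) - of_nat N * (LINT x|unit_measure. u x)) -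
      of_nat N * (\<Sum>m\<in>sym_freqs M. osc_integral (- (m * int N)) u)) \<longlonglongrightarrow> 0" by simp
  from tendsto_diff[OF tendsto_const this, of "(\<Sum>j=1..N. u (real j / real N)) - of_nat N * (LINT x|unit_measure. u x)"]
  have "(\<lambda>M. of_nat N * (\<Sum>m\<in>sym_freqs M. osc_integral (- (m * int N)) u)) \<longlonglongrightarrow>
     (\<Sum>j=1..N. u (real j / real N)) - of_nat N * (LINT x|unit_measure. u x)" by simp
  from tendsto_divide[OF this tendsto_const[of "of_nat N"]]
  show ?thesis using N by (simp add: diff_divide_distrib)
qed

section \<open>Worst-case errors\<close>

text \<open>
  The comparison \<open>(2 M + 1)\<^sup>2 \<ge> M (M + 1)\<close> makes the sum telescope. For \<open>M = 0\<close> the bound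
  reads \<open>2\<close>, since \<open>1 / 0 = 0\<close>.
\<close>

lemma sum_inverse_odd_squares_le: "(\<Sum>n<M. 1 / (2 * real n + 1)\<^sup>2) \<le> 2 - 1 / real M"
proof (induction M)
  case (Suc M)
  show ?case
  proof (cases "M = 0")
    case False
    have "1 / (2 * real M + 1)\<^sup>2 \<le> 1 / (real M * (real M + 1))"
      using False by (intro frac_le) (auto simp: power2_eq_square algebra_simps intro: add_pos_pos)
    also have "\<dots> = 1 / real M - 1 / (real M + 1)"
      using False by (simp add: field_simps)
    finally show ?thesis using Suc by (simp add: add.commute)
  qed simp
qed simp

text \<open>
  The factor \<open>3\<close> is forced by the extreme case \<open>N = 2 \<bar>k\<bar>\<close>, \<open>m = \<plusminus>1\<close>, where the aliased frequency
  can have a modulus as small as \<open>N - \<bar>k\<bar> = (N + \<bar>k\<bar>) / 3\<close>.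
\<close>

lemma aliased_freq_ge:
  fixes k m :: int
  assumes "2 * \<bar>k\<bar> \<le> int N" "m \<noteq> 0"
  shows "(2 * real_of_int \<bar>m\<bar> - 1) * (real N + \<bar>real_of_int k\<bar>) \<le> 3 * \<bar>real_of_int (k - m * int N)\<bar>"
proof -
  \<comment> \<open>This product is the difference of the two sides of the next inequality.\<close>
  have "0 \<le> (\<bar>m\<bar> + 1) * (int N - 2 * \<bar>k\<bar>)" using assms by simp
  then have "(2 * \<bar>m\<bar> - 1) * (int N + \<bar>k\<bar>) \<le> 3 * (\<bar>m\<bar> * int N - \<bar>k\<bar>)"
    by (simp add: algebra_simps)
  also have "\<bar>m\<bar> * int N - \<bar>k\<bar> \<le> \<bar>k - m * int N\<bar>"
    using abs_triangle_ineq2[of "m * int N" k] by (simp add: abs_mult abs_minus_commute)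
  finally have "real_of_int ((2 * \<bar>m\<bar> - 1) * (int N + \<bar>k\<bar>)) \<le> real_of_int (3 * \<bar>k - m * int N\<bar>)"
    by linarith
  then show ?thesis by simp
qed

text \<open>
  Relative to the reference value \<open>D = 3 / (2 \<pi> (N + \<bar>k\<bar>))\<close>, the reciprocal at \<open>m\<close> is at most
  \<open>1 / (2 \<bar>m\<bar> - 1)\<close>. One factor \<open>2\<close> comes from the two signs of \<open>m\<close>, another one from the sum of
  the inverse odd squares; the square root of their product is the factor \<open>2\<close> of the final
  bound.
\<close>

lemma sum_aliased_weights_le:
  fixes k :: int
  assumes k: "2 * \<bar>k\<bar> \<le> int N" and N: "N \<ge> 1" and s: "s \<ge> 1"
  shows "(\<Sum>m\<in>sym_freqs M. (1 / (2 * pi * \<bar>real_of_int (k - m * int N)\<bar>) ^ s)\<^sup>2) \<le>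
    (2 * (3 / (2 * pi * (real N + \<bar>real_of_int k\<bar>))) ^ s)\<^sup>2"
proof -
  define D where "D = 3 / (2 * pi * (real N + \<bar>real_of_int k\<bar>))"
  have D: "D > 0" using N by (simp add: D_def divide_pos_pos add_pos_nonneg)
  have "(\<Sum>m\<in>sym_freqs M. (1 / (2 * pi * \<bar>real_of_int (k - m * int N)\<bar>) ^ s)\<^sup>2) \<le>
    (\<Sum>m\<in>sym_freqs M. (D ^ s)\<^sup>2 * (1 / (2 * real_of_int \<bar>m\<bar> - 1)\<^sup>2))"
  proof (rule sum_mono)
    fix m assume "m \<in> sym_freqs M"
    then have m: "m \<noteq> 0" by (simp add: sym_freqs_def)
    define d where "d = 2 * real_of_int \<bar>m\<bar> - 1"
    have d: "d \<ge> 1" using m by (simp add: d_def)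
    have NK: "real N + \<bar>real_of_int k\<bar> > 0" using N by (simp add: add_pos_nonneg)
    have pos: "d * (real N + \<bar>real_of_int k\<bar>) > 0" using d NK by simp
    have ge: "d * (real N + \<bar>real_of_int k\<bar>) \<le> 3 * \<bar>real_of_int (k - m * int N)\<bar>"
      unfolding d_def by (rule aliased_freq_ge[OF k m])
    have "3 / (2 * pi * (3 * \<bar>real_of_int (k - m * int N)\<bar>)) \<le>
        3 / (2 * pi * (d * (real N + \<bar>real_of_int k\<bar>)))"
      using order_less_le_trans[OF pos ge]
      by (intro divide_left_mono mult_left_mono ge mult_pos_pos pos) auto
    then have "1 / (2 * pi * \<bar>real_of_int (k - m * int N)\<bar>) \<le> D / d"
      by (simp add: D_def mult_ac)
    then have "(1 / (2 * pi * \<bar>real_of_int (k - m * int N)\<bar>)) ^ (2 * s) \<le> (D / d) ^ (2 * s)"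
      by (intro power_mono) auto
    also have "\<dots> = (D ^ s)\<^sup>2 * (1 / d ^ (2 * s))"
      by (simp add: power_divide power_mult[symmetric] mult.commute)
    also have "\<dots> \<le> (D ^ s)\<^sup>2 * (1 / d\<^sup>2)"
      using d s by (intro mult_left_mono divide_left_mono power_increasing) auto
    finally show "(1 / (2 * pi * \<bar>real_of_int (k - m * int N)\<bar>) ^ s)\<^sup>2 \<le> (D ^ s)\<^sup>2 * (1 / (2 * real_of_int \<bar>m\<bar> - 1)\<^sup>2)"
      by (simp add: d_def power_divide power_mult[symmetric] mult.commute)
  qed
  also have "\<dots> = (D ^ s)\<^sup>2 * (2 * (\<Sum>n<M. 1 / (2 * real n + 1)\<^sup>2))"
    unfolding sum_sym_freqs sum_distrib_left by (intro sum.cong refl) (simp add: algebra_simps)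
  also have "\<dots> \<le> (D ^ s)\<^sup>2 * (2 * 2)"
    using sum_inverse_odd_squares_le[of M] by (intro mult_left_mono) (auto intro: order_trans)
  finally show ?thesis by (simp add: D_def power_mult_distrib)
qed

lemma has_L2_derivative_cmult:
  assumes "has_L2_derivative F f"
  shows "has_L2_derivative (\<lambda>x. c * F x) (\<lambda>x. c * f x)"
  using has_L2_derivative_mult[OF assms, of "\<lambda>_. c" "\<lambda>_. 0"]
    has_L2_derivative_C1[of "\<lambda>_. c" "\<lambda>_. 0"] by (simp add: mult.commute)

lemma has_L2_derivative_sum:
  assumes "\<And>i. i < (n::nat) \<Longrightarrow> has_L2_derivative (F i) (f i)"
  shows "has_L2_derivative (\<lambda>x. \<Sum>i<n. F i x) (\<lambda>x. \<Sum>i<n. f i x)"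
  using assms
proof (induction n)
  case 0
  show ?case using has_L2_derivative_C1[of "\<lambda>_. 0" "\<lambda>_. 0"] by simp
next
  case (Suc n)
  then show ?case using has_L2_derivative_add by simp
qed

lemma bernoulli_part_has_L2_derivative:
  "has_L2_derivative (bernoulli_part f j)
     (\<lambda>x. \<Sum>m<j. (hderiv m f 1 - hderiv m f 0) * of_real (bernoulli_normalized m x))"
  unfolding bernoulli_part_def[abs_def]
  using bernoulli_normalized_has_L2_derivative
  by (intro has_L2_derivative_sum has_L2_derivative_cmult) simp

lemma bernoulli_part_jump:
  assumes "j \<ge> 1"
  shows "bernoulli_part f j 1 - bernoulli_part f j 0 = f 1 - f 0"
proof -
  have "bernoulli_part f j 1 - bernoulli_part f j 0 =
     (\<Sum>m<j. (hderiv m f 1 - hderiv m f 0) * of_real (bernoulli_normalized (Suc m) 1 - bernoulli_normalized (Suc m) 0))"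
    by (simp add: bernoulli_part_def sum_subtractf[symmetric] right_diff_distrib)
  also have "\<dots> = (\<Sum>m<j. if m = 0 then f 1 - f 0 else 0)"
    unfolding bernoulli_normalized_jump by (intro sum.cong) auto
  also have "\<dots> = f 1 - f 0" using assms by simp
  finally show ?thesis .
qed

text \<open>
  The function \<open>u x = (f x - bernoulli_part f s x) * osc k x\<close> is periodic; its mean is
  \<open>I\<^sub>k(f - bernoulli_part f s)\<close>, and its rectangle sum is the approximation of this
  integral by \<open>A_star\<close>. Its coefficients at multiples of \<open>N\<close> are the coefficients of
  \<open>hderiv s f\<close> at the aliased frequencies, divided by the \<open>s\<close>-th power of their eigenvalues.
  Cauchy-Schwarz and Bessel's inequality finish the estimate.
\<close>

lemma quadrature_error_le:
  assumes f: "f \<in> Hs s" "Hs_norm s f \<le> 1" and s: "s \<ge> 1" and k: "k \<noteq> 0" and N: "2 * \<bar>k\<bar> \<le> int N"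
  shows "norm (osc_integral k f - (osc_integral k (bernoulli_part f s) + A_star k N (\<lambda>x. f x - bernoulli_part f s x)))
    \<le> 2 * (3 / (2 * pi * (real N + \<bar>real_of_int k\<bar>))) ^ s"
proof -
  have N1: "N \<ge> 1" using N k by linarith
  define p where "p = bernoulli_part f s"
  define g where "g x = f x - p x" for x
  have df: "has_L2_derivative f (hderiv 1 f)"
    using Hs_has_L2_derivative[OF f(1), of 0] s by simp
  obtain p' where dp: "has_L2_derivative p p'"
    unfolding p_def using bernoulli_part_has_L2_derivative by blast
  have sq: "square_integrable f" "square_integrable p"
    using df dp has_L2_derivative_continuous square_integrable_continuous by blast+
  have dg: "has_L2_derivative g (\<lambda>x. hderiv 1 f x - p' x)"
    using has_L2_derivative_add[OF df has_L2_derivative_cmult[OF dp, of "-1"]] by (simp add: g_def[abs_def])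
  have g01: "g 0 = g 1"
    using bernoulli_part_jump[OF s, of f] by (simp add: g_def p_def algebra_simps)
  define u where "u x = g x * osc k x" for x
  have "continuous_on {0..1} (\<lambda>x. - freq k * osc k x)" by (intro continuous_intros)
  then obtain u' where du: "has_L2_derivative u u'"
    using has_L2_derivative_mult[OF dg osc_has_L2_derivative[of k]] unfolding u_def[abs_def] by blast
  have u01: "u 0 = u 1" using g01 by (simp add: u_def)
  have int_u: "(LINT x|unit_measure. u x) = osc_integral k g"
    by (simp add: u_def osc_integral_eq)
  have A: "A_star k N g = (\<Sum>j=1..N. u (real j / real N)) / of_nat N"
    using N1 N by (simp add: A_star_def u_def osc_def)
  have "osc_integral k g = osc_integral k f - osc_integral k p"
    unfolding g_def[abs_def] by (rule osc_integral_diff[OF sq])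
  then have err: "osc_integral k f - (osc_integral k p + A_star k N g) =
     - ((\<Sum>j=1..N. u (real j / real N)) / of_nat N - (LINT x|unit_measure. u x))"
    by (simp add: A int_u)
  have sqs: "square_integrable (hderiv s f)"
    by (rule Hs_square_integrable_hderiv[OF f(1) s order_refl])
  have coeff: "osc_integral (- (m * int N)) u = osc_integral (k - m * int N) (hderiv s f) / freq (k - m * int N) ^ s"
    if m: "m \<noteq> 0" for m
  proof -
    have "k - m * int N \<noteq> 0"
    proof
      assume "k - m * int N = 0"
      then have "\<bar>k\<bar> = \<bar>m\<bar> * int N" by (simp add: abs_mult)
      moreover have "1 * int N \<le> \<bar>m\<bar> * int N" using m by (intro mult_right_mono) auto
      ultimately show False using N k by linarith
    qed
    then have "osc_integral (k - m * int N) g = osc_integral (k - m * int N) (hderiv s f) / freq (k - m * int N) ^ s"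
      using osc_integral_minus_bernoulli_part[OF f(1) order_refl, of "k - m * int N"]
        osc_integral_diff[OF sq, of "k - m * int N"] by (simp add: g_def[abs_def] p_def)
    moreover have "osc_integral (- (m * int N)) u = osc_integral (k - m * int N) g"
      using osc_add[of k "- (m * int N)"] by (simp add: osc_integral_eq u_def mult.assoc)
    ultimately show ?thesis by simp
  qed
  define B where "B = 2 * (3 / (2 * pi * (real N + \<bar>real_of_int k\<bar>))) ^ s"
  have B: "B \<ge> 0" by (simp add: B_def)
  have partial: "norm (\<Sum>m\<in>sym_freqs M. osc_integral (- (m * int N)) u) \<le> B" for M
  proof -
    define a where "a m = 1 / (2 * pi * \<bar>real_of_int (k - m * int N)\<bar>) ^ s" for m
    define b where "b m = norm (osc_integral (k - m * int N) (hderiv s f))" for m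
    have "norm (\<Sum>m\<in>sym_freqs M. osc_integral (- (m * int N)) u) \<le> (\<Sum>m\<in>sym_freqs M. a m * b m)"
    proof (rule sum_norm_le)
      fix m assume "m \<in> sym_freqs M"
      then have "m \<noteq> 0" by (simp add: sym_freqs_def)
      show "norm (osc_integral (- (m * int N)) u) \<le> a m * b m"
        unfolding coeff[OF \<open>m \<noteq> 0\<close>] norm_divide norm_power norm_freq by (simp add: a_def b_def)
    qed
    moreover have "(\<Sum>m\<in>sym_freqs M. a m * b m)\<^sup>2 \<le> B\<^sup>2"
    proof -
      have "(\<Sum>m\<in>sym_freqs M. a m * b m)\<^sup>2 \<le> (\<Sum>m\<in>sym_freqs M. (a m)\<^sup>2) * (\<Sum>m\<in>sym_freqs M. (b m)\<^sup>2)"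
        by (rule Cauchy_Schwarz_ineq_sum)
      also have "\<dots> \<le> B\<^sup>2 * 1"
      proof (rule mult_mono)
        show "(\<Sum>m\<in>sym_freqs M. (a m)\<^sup>2) \<le> B\<^sup>2"
          unfolding a_def B_def by (rule sum_aliased_weights_le[OF N N1 s])
        have inj: "inj_on (\<lambda>m. k - m * int N) (sym_freqs M)"
          using N1 by (auto simp: inj_on_def)
        have "(\<Sum>m\<in>sym_freqs M. (b m)\<^sup>2) = (\<Sum>r\<in>(\<lambda>m. k - m * int N) ` sym_freqs M. (norm (osc_integral r (hderiv s f)))\<^sup>2)"
          by (simp add: sum.reindex[OF inj] b_def)
        also have "\<dots> \<le> L2_norm_sq (hderiv s f)"
          by (rule Bessel_inequality[OF sqs]) simp
        also have "\<dots> \<le> 1" by (rule L2_norm_sq_hderiv_le[OF f(1) order_refl f(2)])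
        finally show "(\<Sum>m\<in>sym_freqs M. (b m)\<^sup>2) \<le> 1" .
      qed (auto intro: sum_nonneg)
      finally show ?thesis by simp
    qed
    ultimately show ?thesis using power2_le_imp_le B by fastforce
  qed
  have "norm ((\<Sum>j=1..N. u (real j / real N)) / of_nat N - (LINT x|unit_measure. u x)) \<le> B"
    using partial by (intro Lim_norm_ubound[OF _ aliasing[OF N1 du u01]]) auto
  then show ?thesis
    unfolding B_def[symmetric] err[unfolded p_def g_def[abs_def]] norm_minus_cancel p_def .
qed

theorem theorem13:
  fixes s :: nat and k :: int
  assumes "s \<ge> 1" and "k \<noteq> 0"
  shows "(\<forall>n. even n \<and> 2 \<le> n \<and> n \<le> 2 * s \<longrightarrow>
            wc_error s k (A_Per s k n) \<le> ereal (1 / (2 * pi * \<bar>real_of_int k\<bar>) ^ (n div 2))) \<and>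
         (\<forall>n. n > 2 * s \<longrightarrow>
            wc_error s k (A_Per s k n)
              \<le> ereal ((3 / (2 * pi)) ^ s * (2 / (real n - 2 * real s + 1 + \<bar>real_of_int k\<bar>) ^ s)))"
proof (intro conjI allI impI)
  fix n assume n: "even n \<and> 2 \<le> n \<and> n \<le> 2 * s"
  have A: "A_Per s k n f = osc_integral k (bernoulli_part f (n div 2))" for f
  proof (cases "n = 2 * s")
    \<comment> \<open>For \<open>n = 2 s\<close> the quadrature rule has one node, fewer than \<open>2 \<bar>k\<bar>\<close>, and is therefore zero.\<close>
    case True
    then show ?thesis using assms by (simp add: A_Per_def A_star_def)
  next
    case False
    then show ?thesis using n by (simp add: A_Per_def)
  qed
  show "wc_error s k (A_Per s k n) \<le> ereal (1 / (2 * pi * \<bar>real_of_int k\<bar>) ^ (n div 2))"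
    unfolding wc_error_def A using assms n
    by (intro SUP_least) (auto intro!: osc_integral_minus_bernoulli_part_le)
next
  fix n assume n: "n > 2 * s"
  define N where "N = n - 2 * s + 1"
  define D where "D = 3 / (2 * pi * (real N + \<bar>real_of_int k\<bar>))"
  have A: "A_Per s k n f = osc_integral k (bernoulli_part f s) + A_star k N (\<lambda>x. f x - bernoulli_part f s x)" for f
    using n by (simp add: A_Per_def N_def)
  have "(3 / (2 * pi)) ^ s * (2 / (real n - 2 * real s + 1 + \<bar>real_of_int k\<bar>) ^ s) = 2 * D ^ s"
  proof -
    have "real n - 2 * real s + 1 = real N" using n by (simp add: N_def of_nat_diff)
    then show ?thesis by (simp add: D_def power_divide power_mult_distrib)
  qed
  moreover have "norm (osc_integral k f - A_Per s k n f) \<le> 2 * D ^ s"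
    if f: "f \<in> Hs s" "Hs_norm s f \<le> 1" for f
  proof (cases "2 * \<bar>k\<bar> \<le> int N")
    case True
    then show ?thesis
      unfolding A D_def by (rule quadrature_error_le[OF f assms])
  next
    \<comment> \<open>With too few nodes the quadrature rule is zero; then \<open>N + \<bar>k\<bar> < 3 \<bar>k\<bar>\<close> turns the bound of
      the first part into the required one.\<close>
    case False
    then have "A_Per s k n f = osc_integral k (bernoulli_part f s)"
      by (simp add: A A_star_def)
    then have "norm (osc_integral k f - A_Per s k n f) \<le> 1 / (2 * pi * \<bar>real_of_int k\<bar>) ^ s"
      using osc_integral_minus_bernoulli_part_le[OF f assms(1) order_refl assms(2)] by simp
    also have "\<dots> = (1 / (2 * pi * \<bar>real_of_int k\<bar>)) ^ s" by (simp add: power_divide)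
    also have "\<dots> \<le> D ^ s"
    proof (rule power_mono)
      have "real N + \<bar>real_of_int k\<bar> \<le> 3 * \<bar>real_of_int k\<bar>" using False by linarith
      moreover have "real N + \<bar>real_of_int k\<bar> > 0" by (simp add: N_def)
      ultimately have "3 / (2 * pi * (3 * \<bar>real_of_int k\<bar>)) \<le> D"
        unfolding D_def by (intro divide_left_mono mult_left_mono mult_pos_pos) auto
      then show "1 / (2 * pi * \<bar>real_of_int k\<bar>) \<le> D" by simp
    qed simp
    also have "\<dots> \<le> 2 * D ^ s" by (simp add: D_def)
    finally show ?thesis .
  qed
  ultimately show "wc_error s k (A_Per s k n)
      \<le> ereal ((3 / (2 * pi)) ^ s * (2 / (real n - 2 * real s + 1 + \<bar>real_of_int k\<bar>) ^ s))"
    unfolding wc_error_def by (intro SUP_least) auto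
qed

end
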